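(* Let $\mathcal{H}$ be a separable complex Hilbert space (possibly infinite dimensional) and let $\rho$ be a DSO state on $\mathcal{H}\otimes\mathcal{H}$ that has a density source-operator $R$ with the property $$\mathrm{tr}_{\mathcal{H}}^{(1)}[R]=\mathrm{tr}_{\mathcal{H}}^{(2)}[R]=\mathrm{tr}_{\mathcal{H}}^{(3)}[R]=\rho .$$ Then $\rho$ satisfies the perfect correlation form of the original Bell inequality, that is, both $$\left|\,\mathrm{tr}[\rho(W_{1}\otimes W_{2})]-\mathrm{tr}[\rho(W_{1}\otimes\widetilde{W}_{2})]\,\right|\leq 1-\mathrm{tr}[\rho(W_{2}\otimes\widetilde{W}_{2})]$$ and $$\left|\,\mathrm{tr}[\rho(W_{1}\otimes W_{2})]-\mathrm{tr}[\rho(\widetilde{W}_{1}\otimes W_{2})]\,\right|\leq 1-\mathrm{tr}[\rho(W_{1}\otimes\widetilde{W}_{1})]$$ hold for any bounded quantum observables $W_{1},\widetilde{W}_{1},W_{2},\widetilde{W}_{2}$ on $\mathcal{H}$ with operator norms $\|\cdot\|\leq 1$.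
   Context: A quantum state on a Hilbert space is a density operator, i.e. a positive trace class operator of trace $1$. A bounded quantum observable on $\mathcal{H}$ is a bounded self-adjoint operator on $\mathcal{H}$. For $k=1,2,3$, $\mathrm{tr}_{\mathcal{H}}^{(k)}[\cdot]$ denotes the partial trace over the $k$-th tensor factor of $\mathcal{H}\otimes\mathcal{H}\otimes\mathcal{H}$; the result is regarded as an operator on $\mathcal{H}\otimes\mathcal{H}$, the two remaining factors being kept in their order. Let $\rho$ be a state on $\mathcal{H}\otimes\mathcal{H}$. A source-operator for $\rho$ is a self-adjoint trace class operator on $\mathcal{H}\otimes\mathcal{H}\otimes\mathcal{H}$ that is either of type $T_{\blacktriangleright}$, meaning $$\mathrm{tr}_{\mathcal{H}}^{(2)}[T_{\blacktriangleright}]=\mathrm{tr}_{\mathcal{H}}^{(3)}[T_{\blacktriangleright}]=\rho,$$ or of type $T_{\blacktriangleleft}$, meaning $$\mathrm{tr}_{\mathcal{H}}^{(1)}[T_{\blacktriangleleft}]=\mathrm{tr}_{\mathcal{H}}^{(2)}[T_{\blacktriangleleft}]=\rho.$$ A density source-operator (DSO) for $\rho$ is a positive source-operator for $\rho$ (of either type); it is then automatically a density operator. The state $\rho$ is called a DSO state if there exists a density source-operator for $\rho$. *)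

theory Defs
  imports "HOL-Analysis.Analysis" "HOL-Library.Complex_Order"
begin

section \<open>Complex Hilbert spaces\<close>

text \<open>The inner product is linear in the second argument. The last axiom says that the norm is the
  one induced by the inner product; together with the norm axioms it gives positive definiteness.\<close>

class complex_inner = real_normed_vector +
  fixes scaleC :: "complex \<Rightarrow> 'a \<Rightarrow> 'a" (infixr "*\<^sub>C" 75)
    and cinner :: "'a \<Rightarrow> 'a \<Rightarrow> complex"
  assumes scaleC_add_right: "a *\<^sub>C (x + y) = a *\<^sub>C x + a *\<^sub>C y"
    and scaleC_add_left: "(a + b) *\<^sub>C x = a *\<^sub>C x + b *\<^sub>C x"
    and scaleC_scaleC: "a *\<^sub>C (b *\<^sub>C x) = (a * b) *\<^sub>C x"
    and scaleR_scaleC: "r *\<^sub>R x = complex_of_real r *\<^sub>C x"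
    and cinner_commute: "cinner x y = cnj (cinner y x)"
    and cinner_add_right: "cinner x (y + z) = cinner x y + cinner x z"
    and cinner_scaleC_right: "cinner x (a *\<^sub>C y) = a * cinner x y"
    and cinner_self: "cinner x x = complex_of_real ((norm x)\<^sup>2)"

class chilbert_space = complex_inner + complete_space

instantiation complex :: chilbert_space
begin

definition scaleC_complex :: "complex \<Rightarrow> complex \<Rightarrow> complex"
  where "scaleC_complex = (*)"

definition cinner_complex :: "complex \<Rightarrow> complex \<Rightarrow> complex"
  where "cinner_complex x y = cnj x * y"

instance
  by standard
    (simp_all add: scaleC_complex_def cinner_complex_def algebra_simps scaleR_conv_of_real
      complex_norm_square[symmetric] del: of_real_power)

end

lemma scaleC_one: "1 *\<^sub>C x = (x :: 'a :: complex_inner)"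
  using scaleR_scaleC[of 1 x] by simp

global_interpretation complex_vector: vector_space "scaleC :: complex \<Rightarrow> 'a \<Rightarrow> 'a :: complex_inner"
  defines cspan = complex_vector.span
  by unfold_locales (simp_all add: scaleC_add_right scaleC_add_left scaleC_scaleC scaleC_one)

abbreviation clinear :: "('a :: complex_inner \<Rightarrow> 'b :: complex_inner) \<Rightarrow> bool"
  where "clinear \<equiv> Vector_Spaces.linear (*\<^sub>C) (*\<^sub>C)"

definition is_onb :: "'a :: chilbert_space set \<Rightarrow> bool"
  where "is_onb B \<longleftrightarrow> (\<forall>e\<in>B. norm e = 1) \<and> pairwise (\<lambda>e f. cinner e f = 0) B \<and>
    closure (cspan B) = UNIV"

text \<open>A fixed orthonormal basis of each space. The traces below are computed in this basis; for trace
  class operators their values do not depend on it.\<close>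

definition some_onb :: "'a :: chilbert_space set"
  where "some_onb = (SOME B. is_onb B)"


section \<open>Operators, trace class and trace\<close>

definition bounded_clinear :: "('a :: complex_inner \<Rightarrow> 'b :: complex_inner) \<Rightarrow> bool"
  where "bounded_clinear A \<longleftrightarrow> clinear A \<and> bounded_linear A"

definition self_adjoint :: "('a :: chilbert_space \<Rightarrow> 'a) \<Rightarrow> bool"
  where "self_adjoint A \<longleftrightarrow> bounded_clinear A \<and> (\<forall>x y. cinner (A x) y = cinner x (A y))"

text \<open>\<open>\<le>\<close> on the complex numbers is that of \<^theory>\<open>HOL-Library.Complex_Order\<close>:
  \<open>z \<le> w\<close> includes the claim that \<open>w - z\<close> is real.\<close>

definition positive_op :: "('a :: chilbert_space \<Rightarrow> 'a) \<Rightarrow> bool"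
  where "positive_op A \<longleftrightarrow> self_adjoint A \<and> (\<forall>x. 0 \<le> cinner x (A x))"

text \<open>The absolute value \<open>\<bar>A\<bar>\<close>, that is, the positive square root of \<open>A* A\<close>; the equation
  \<open>\<bar>A\<bar>\<^sup>2 = A* A\<close> is written with matrix elements.\<close>

definition abs_op :: "('a :: chilbert_space \<Rightarrow> 'a) \<Rightarrow> 'a \<Rightarrow> 'a"
  where "abs_op A = (THE P. positive_op P \<and> (\<forall>x y. cinner x (P (P y)) = cinner (A x) (A y)))"

definition trace_class :: "('a :: chilbert_space \<Rightarrow> 'a) \<Rightarrow> bool"
  where "trace_class A \<longleftrightarrow> bounded_clinear A \<and> (\<lambda>e. cinner e (abs_op A e)) summable_on some_onb"

definition tr :: "('a :: chilbert_space \<Rightarrow> 'a) \<Rightarrow> complex"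
  where "tr A = (\<Sum>\<^sub>\<infinity>e\<in>some_onb. cinner e (A e))"

definition quantum_state :: "('a :: chilbert_space \<Rightarrow> 'a) \<Rightarrow> bool"
  where "quantum_state \<rho> \<longleftrightarrow> positive_op \<rho> \<and> trace_class \<rho> \<and> tr \<rho> = 1"


section \<open>Hilbert tensor products\<close>

text \<open>\<open>hilbert_tensor t\<close> says that the Hilbert space \<open>'c\<close>, with \<open>x \<otimes> y = t x y\<close>, is a Hilbert space tensor
  product of \<open>'a\<close> and \<open>'b\<close>. This determines \<open>('c, t)\<close> up to a unique unitary map, so a
  statement about all such pairs is a statement about the tensor product.\<close>

definition hilbert_tensor ::
    "('a :: chilbert_space \<Rightarrow> 'b :: chilbert_space \<Rightarrow> 'c :: chilbert_space) \<Rightarrow> bool"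
  where "hilbert_tensor t \<longleftrightarrow>
    (\<forall>y. clinear (\<lambda>x. t x y)) \<and> (\<forall>x. clinear (\<lambda>y. t x y)) \<and>
    (\<forall>x y x' y'. cinner (t x y) (t x' y') = cinner x x' * cinner y y') \<and>
    closure (cspan {t x y |x y. True}) = UNIV"

definition tensor_op :: "('a :: chilbert_space \<Rightarrow> 'b :: chilbert_space \<Rightarrow> 'c :: chilbert_space) \<Rightarrow>
    ('a \<Rightarrow> 'a) \<Rightarrow> ('b \<Rightarrow> 'b) \<Rightarrow> 'c \<Rightarrow> 'c"
  where "tensor_op t A B = (THE C. bounded_clinear C \<and> (\<forall>x y. C (t x y) = t (A x) (B y)))"

text \<open>Below, \<open>t\<close> realizes \<open>H \<otimes> H\<close> on \<open>'k\<close> and \<open>u\<close> realizes \<open>(H \<otimes> H) \<otimes> H\<close> on \<open>'l\<close>, so that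
  \<open>x \<otimes> y \<otimes> z = u (t x y) z\<close>. \<open>has_ptrace1 t u T S\<close> says that the bounded operator \<open>S\<close> is the partial
  trace of \<open>T\<close> over the first factor, that is,
  \<open>\<langle>x \<otimes> y, S (x' \<otimes> y')\<rangle> = (\<Sum>e. \<langle>e \<otimes> x \<otimes> y, T (e \<otimes> x' \<otimes> y')\<rangle>)\<close>,
  and similarly for the other two factors. Matrix elements between product vectors determine \<open>S\<close>.\<close>

definition has_ptrace1 ::
    "('h :: chilbert_space \<Rightarrow> 'h \<Rightarrow> 'k :: chilbert_space) \<Rightarrow> ('k \<Rightarrow> 'h \<Rightarrow> 'l :: chilbert_space) \<Rightarrow>
     ('l \<Rightarrow> 'l) \<Rightarrow> ('k \<Rightarrow> 'k) \<Rightarrow> bool"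
  where "has_ptrace1 t u T S \<longleftrightarrow> bounded_clinear S \<and>
    (\<forall>x y x' y'. ((\<lambda>e. cinner (u (t e x) y) (T (u (t e x') y')))
      has_sum cinner (t x y) (S (t x' y'))) some_onb)"

definition has_ptrace2 ::
    "('h :: chilbert_space \<Rightarrow> 'h \<Rightarrow> 'k :: chilbert_space) \<Rightarrow> ('k \<Rightarrow> 'h \<Rightarrow> 'l :: chilbert_space) \<Rightarrow>
     ('l \<Rightarrow> 'l) \<Rightarrow> ('k \<Rightarrow> 'k) \<Rightarrow> bool"
  where "has_ptrace2 t u T S \<longleftrightarrow> bounded_clinear S \<and>
    (\<forall>x y x' y'. ((\<lambda>e. cinner (u (t x e) y) (T (u (t x' e) y')))
      has_sum cinner (t x y) (S (t x' y'))) some_onb)"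

definition has_ptrace3 ::
    "('h :: chilbert_space \<Rightarrow> 'h \<Rightarrow> 'k :: chilbert_space) \<Rightarrow> ('k \<Rightarrow> 'h \<Rightarrow> 'l :: chilbert_space) \<Rightarrow>
     ('l \<Rightarrow> 'l) \<Rightarrow> ('k \<Rightarrow> 'k) \<Rightarrow> bool"
  where "has_ptrace3 t u T S \<longleftrightarrow> bounded_clinear S \<and>
    (\<forall>x y x' y'. ((\<lambda>e. cinner (u (t x y) e) (T (u (t x' y') e)))
      has_sum cinner (t x y) (S (t x' y'))) some_onb)"


section \<open>Source operators\<close>

definition source_operator_right ::
    "('h :: chilbert_space \<Rightarrow> 'h \<Rightarrow> 'k :: chilbert_space) \<Rightarrow> ('k \<Rightarrow> 'h \<Rightarrow> 'l :: chilbert_space) \<Rightarrow>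
     ('k \<Rightarrow> 'k) \<Rightarrow> ('l \<Rightarrow> 'l) \<Rightarrow> bool"
  where "source_operator_right t u \<rho> T \<longleftrightarrow>
    self_adjoint T \<and> trace_class T \<and> has_ptrace2 t u T \<rho> \<and> has_ptrace3 t u T \<rho>"

definition source_operator_left ::
    "('h :: chilbert_space \<Rightarrow> 'h \<Rightarrow> 'k :: chilbert_space) \<Rightarrow> ('k \<Rightarrow> 'h \<Rightarrow> 'l :: chilbert_space) \<Rightarrow>
     ('k \<Rightarrow> 'k) \<Rightarrow> ('l \<Rightarrow> 'l) \<Rightarrow> bool"
  where "source_operator_left t u \<rho> T \<longleftrightarrow>
    self_adjoint T \<and> trace_class T \<and> has_ptrace1 t u T \<rho> \<and> has_ptrace2 t u T \<rho>"

definition density_source_operator ::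
    "('h :: chilbert_space \<Rightarrow> 'h \<Rightarrow> 'k :: chilbert_space) \<Rightarrow> ('k \<Rightarrow> 'h \<Rightarrow> 'l :: chilbert_space) \<Rightarrow>
     ('k \<Rightarrow> 'k) \<Rightarrow> ('l \<Rightarrow> 'l) \<Rightarrow> bool"
  where "density_source_operator t u \<rho> R \<longleftrightarrow>
    (source_operator_right t u \<rho> R \<or> source_operator_left t u \<rho> R) \<and> positive_op R"

definition DSO_state ::
    "('h :: chilbert_space \<Rightarrow> 'h \<Rightarrow> 'k :: chilbert_space) \<Rightarrow> ('k \<Rightarrow> 'h \<Rightarrow> 'l :: chilbert_space) \<Rightarrow>
     ('k \<Rightarrow> 'k) \<Rightarrow> bool"
  where "DSO_state t u \<rho> \<longleftrightarrow> quantum_state \<rho> \<and> (\<exists>R. density_source_operator t u \<rho> R)"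

end

theory Submission
  imports Defs
begin

text \<open>Write \<open>\<tau>(A, B) = tr[\<rho> (A \<otimes> B)]\<close>. Since all three partial traces of \<open>R\<close> are \<open>\<rho>\<close>, the numbers
  \<open>\<tau>(A, B)\<close>, \<open>\<tau>(A, C)\<close>, \<open>\<tau>(B, C)\<close> are the traces of \<open>R\<close> against \<open>A \<otimes> B \<otimes> 1\<close>, \<open>A \<otimes> 1 \<otimes> C\<close>, \<open>1 \<otimes> B \<otimes> C\<close>.
  For self-adjoint contractions, \<open>1 + \<tau>(A, B) + \<tau>(A, C) + \<tau>(B, C)\<close> is nonnegative, because the operator
  \<open>1 + A \<otimes> B \<otimes> 1 + A \<otimes> 1 \<otimes> C + 1 \<otimes> B \<otimes> C\<close> is half the sum of \<open>(1 + A) \<otimes> (1 + B) \<otimes> (1 + C)\<close> and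
  \<open>(1 - A) \<otimes> (1 - B) \<otimes> (1 - C)\<close>, both squares of self-adjoint operators. Flipping the sign of one of the
  three operators gives each of the four one-sided inequalities.\<close>

section \<open>Complex inner products\<close>

text \<open>Two definitions shape the work. \<open>tr\<close> is computed in an arbitrarily chosen
  basis \<open>some_onb\<close>, whereas partial traces are sums over product vectors, so matching
  the traces requires independence of the basis. This comes from writing R = S^2 with S self-adjoint
  and Hilbert-Schmidt: the trace of R T becomes a sum of terms \<langle>S w, T S w\<rangle> over an
  orthonormal basis, where nonnegativity of an operator applies term by term.
  \<open>tensor_op\<close> is a definite description, which yields nothing until a bounded operator
  with the required values on product vectors exists; the difficulty is to bound A \<otimes> B on
  finite sums of such vectors, each of which has many representations. Square roots are the common
  tool: they factor R, they make A \<otimes> 1 contractive, and they turn (1 + A) / 2 into a square.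
  Since the order on the complex numbers includes reality, no separate argument is needed that the
  traces are real: nonnegativity delivers it with the bound.\<close>

lemma cinner_add_left: "cinner (x + y) z = cinner x z + cinner (y :: 'a :: complex_inner) z"
  by (metis cinner_add_right cinner_commute complex_cnj_add)

lemma cinner_scaleC_left: "cinner (a *\<^sub>C x) y = cnj a * cinner (x :: 'a :: complex_inner) y"
  by (metis cinner_commute cinner_scaleC_right complex_cnj_mult)

lemma cinner_scaleR_right: "cinner (x :: 'a :: complex_inner) (r *\<^sub>R y) = of_real r * cinner x y"
  by (simp add: scaleR_scaleC cinner_scaleC_right)

lemma cinner_scaleR_left: "cinner (r *\<^sub>R x) (y :: 'a :: complex_inner) = of_real r * cinner x y"
  by (simp add: scaleR_scaleC cinner_scaleC_left)

lemma scaleC_minus_one: "(- 1) *\<^sub>C x = - (x :: 'a :: complex_inner)"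
  using scaleR_scaleC[of "-1" x] by simp

lemma cinner_minus_right: "cinner (x :: 'a :: complex_inner) (- y) = - cinner x y"
  using cinner_scaleR_right[of x "-1" y] by simp

lemma cinner_minus_left: "cinner (- x) (y :: 'a :: complex_inner) = - cinner x y"
  using cinner_scaleR_left[of "-1" x y] by simp

lemma cinner_diff_right: "cinner (x :: 'a :: complex_inner) (y - z) = cinner x y - cinner x z"
  using cinner_add_right[of x y "- z"] by (simp add: cinner_minus_right)

lemma cinner_diff_left: "cinner (x - y) (z :: 'a :: complex_inner) = cinner x z - cinner y z"
  using cinner_add_left[of x "- y" z] by (simp add: cinner_minus_left)

lemma cinner_zero_right [simp]: "cinner (x :: 'a :: complex_inner) 0 = 0"
  using cinner_scaleR_right[of x 0 0] by simp

lemma cinner_zero_left [simp]: "cinner 0 (x :: 'a :: complex_inner) = 0"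
  using cinner_scaleR_left[of 0 0 x] by simp

lemmas cinner_algebra =
  cinner_add_left cinner_add_right cinner_diff_left cinner_diff_right
  cinner_minus_left cinner_minus_right cinner_scaleC_left cinner_scaleC_right
  cinner_scaleR_left cinner_scaleR_right

lemma cinner_sum_left:
  "cinner (\<Sum>i\<in>I. f i) (x :: 'a :: complex_inner) = (\<Sum>i\<in>I. cinner (f i) x)"
  by (induction I rule: infinite_finite_induct) (simp_all add: cinner_add_left)

lemma Re_cinner_commute: "Re (cinner x y) = Re (cinner y (x :: 'a :: complex_inner))"
  by (metis cinner_commute complex_cnj cnj.sel(1))

lemma power2_norm_add:
  "(norm (x + y))\<^sup>2 = (norm x)\<^sup>2 + 2 * Re (cinner x y) + (norm (y :: 'a :: complex_inner))\<^sup>2"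
proof -
  have "complex_of_real ((norm (x + y))\<^sup>2)
      = cinner x x + cinner x y + cinner y x + cinner y y"
    unfolding cinner_self[symmetric] by (simp add: cinner_algebra)
  then have "(norm (x + y))\<^sup>2 = Re (cinner x x + cinner x y + cinner y x + cinner y y)"
    by (metis Re_complex_of_real)
  then show ?thesis
    by (simp add: cinner_self Re_cinner_commute[of y x] del: of_real_power)
qed

lemma power2_norm_diff:
  "(norm (x - y))\<^sup>2 = (norm x)\<^sup>2 - 2 * Re (cinner x y) + (norm (y :: 'a :: complex_inner))\<^sup>2"
  using power2_norm_add[of x "- y"] by (simp add: cinner_minus_right)

lemma norm_scaleC: "norm (a *\<^sub>C x) = cmod a * norm (x :: 'a :: complex_inner)"
proof -
  have "complex_of_real ((norm (a *\<^sub>C x))\<^sup>2) = (cnj a * a) * complex_of_real ((norm x)\<^sup>2)"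
    unfolding cinner_self[symmetric] by (simp add: cinner_algebra mult.assoc)
  also have "\<dots> = complex_of_real ((cmod a * norm x)\<^sup>2)"
    by (simp add: power_mult_distrib complex_mult_cnj cmod_def mult.commute[of "cnj a"])
  finally have "(norm (a *\<^sub>C x))\<^sup>2 = (cmod a * norm x)\<^sup>2"
    by (simp only: of_real_eq_iff)
  then show ?thesis
    by simp
qed

text \<open>Cauchy-Schwarz: the vector \<open>n *\<^sub>R x - c *\<^sub>C y\<close> is n times the
  component of x orthogonal to y, scaled to avoid division; its squared norm is nonnegative.\<close>

lemma cmod_cinner_le: "cmod (cinner x y) \<le> norm x * norm (y :: 'a :: complex_inner)"
proof (cases "y = 0")
  case False
  define c where "c = cinner y x"
  define n where "n = (norm y)\<^sup>2"
  have n: "n > 0"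
    using False by (simp add: n_def)
  have xy: "cinner x y = cnj c"
    by (simp add: c_def cinner_commute[symmetric])
  have Re: "Re (cinner (n *\<^sub>R x) (c *\<^sub>C y)) = n * (cmod c)\<^sup>2"
    by (simp add: cinner_algebra xy cmod_power2) (simp add: power2_eq_square algebra_simps)
  have "0 \<le> (norm (n *\<^sub>R x - c *\<^sub>C y))\<^sup>2"
    by simp
  also have "\<dots> = (norm (n *\<^sub>R x))\<^sup>2 - 2 * (n * (cmod c)\<^sup>2) + (norm (c *\<^sub>C y))\<^sup>2"
    by (simp add: power2_norm_diff Re)
  also have "\<dots> = n * (n * (norm x)\<^sup>2 - (cmod c)\<^sup>2)"
    by (simp add: norm_scaleC power_mult_distrib n_def power2_eq_square algebra_simps)
  finally have "(cmod c)\<^sup>2 \<le> (norm x * norm y)\<^sup>2"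
    using n by (simp add: zero_le_mult_iff n_def power_mult_distrib mult.commute)
  then have "cmod c \<le> norm x * norm y"
    by (rule power2_le_imp_le) simp
  then show ?thesis
    by (simp add: xy)
qed simp

lemma bounded_linear_cinner_right: "bounded_linear (cinner (x :: 'a :: complex_inner))"
  by (rule bounded_linear_intro[where K = "norm x"])
    (auto simp: cinner_algebra scaleR_conv_of_real mult.commute intro: order_trans[OF cmod_cinner_le])

lemma bounded_linear_cinner_left: "bounded_linear (\<lambda>x :: 'a :: complex_inner. cinner x y)"
  by (rule bounded_linear_intro[where K = "norm y"])
    (auto simp: cinner_algebra scaleR_conv_of_real cmod_cinner_le)

lemma bounded_linear_scaleC: "bounded_linear (\<lambda>x :: 'a :: complex_inner. a *\<^sub>C x)"
  by (rule bounded_linear_intro[where K = "cmod a"])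
    (auto simp: scaleC_add_right scaleR_scaleC scaleC_scaleC mult.commute norm_scaleC)

lemmas continuous_cinner [continuous_intros] =
  bounded_linear.continuous_on[OF bounded_linear_cinner_right]
  bounded_linear.continuous_on[OF bounded_linear_cinner_left]
  bounded_linear.continuous_on[OF bounded_linear_scaleC]

section \<open>Self-adjoint operators\<close>

lemma clinear_iff:
  "clinear f \<longleftrightarrow> (\<forall>x y. f (x + y) = f x + f y) \<and> (\<forall>c x. f (c *\<^sub>C x) = c *\<^sub>C f x)"
  unfolding Vector_Spaces.linear_iff
  by (simp add: complex_vector.vector_space_axioms)

lemma bounded_clinearI:
  assumes "\<And>x y. A (x + y) = A x + A y" "\<And>c x. A (c *\<^sub>C x) = c *\<^sub>C A x"
    and "\<And>x. norm (A x) \<le> M * norm x"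
  shows "bounded_clinear A"
  unfolding bounded_clinear_def clinear_iff
  using assms by (auto intro!: bounded_linear_intro[where K = M] simp: scaleR_scaleC mult.commute)

lemma
  assumes "bounded_clinear A"
  shows bounded_clinear_add: "A (x + y) = A x + A y"
    and bounded_clinear_scaleC: "A (c *\<^sub>C x) = c *\<^sub>C A x"
    and bounded_clinear_scaleR: "A (r *\<^sub>R x) = r *\<^sub>R A x"
    and bounded_clinear_diff: "A (x - y) = A x - A y"
    and bounded_clinear_minus: "A (- x) = - A x"
    and bounded_clinear_zero: "A 0 = 0"
    and bounded_clinear_bounded_linear: "bounded_linear A"
proof -
  from assms have l: "bounded_linear A" and c: "clinear A"
    by (auto simp: bounded_clinear_def)
  show "A (x + y) = A x + A y" "A (c *\<^sub>C x) = c *\<^sub>C A x"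
    using c by (auto simp: clinear_iff)
  show "bounded_linear A"
    by (rule l)
  interpret bounded_linear A
    by (rule l)
  show "A (r *\<^sub>R x) = r *\<^sub>R A x" "A (x - y) = A x - A y" "A (- x) = - A x" "A 0 = 0"
    by (simp_all add: scaleR diff neg zero)
qed

lemmas bounded_clinear_algebra = bounded_clinear_add bounded_clinear_scaleC bounded_clinear_scaleR
  bounded_clinear_diff bounded_clinear_minus bounded_clinear_zero

lemma bounded_clinear_bound:
  assumes "bounded_clinear A"
  obtains M where "M > 0" "\<And>x. norm (A x) \<le> M * norm x"
  using bounded_linear.pos_bounded[OF bounded_clinear_bounded_linear[OF assms]]
  by (metis mult.commute)

lemma bounded_clinear_compose:
  assumes "bounded_clinear A" "bounded_clinear B"
  shows "bounded_clinear (\<lambda>x. A (B x))"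
  unfolding bounded_clinear_def clinear_iff
  using assms
  by (auto simp: bounded_clinear_algebra
      intro: bounded_linear_compose bounded_clinear_bounded_linear)

lemma self_adjointI:
  assumes "bounded_clinear A" "\<And>x y. cinner (A x) y = cinner x (A y)"
  shows "self_adjoint A"
  using assms by (simp add: self_adjoint_def)

lemma self_adjoint_bounded_clinear: "self_adjoint A \<Longrightarrow> bounded_clinear A"
  by (simp add: self_adjoint_def)

lemma self_adjoint_cinner: "self_adjoint A \<Longrightarrow> cinner (A x) y = cinner x (A y)"
  by (simp add: self_adjoint_def)

lemma self_adjoint_id: "self_adjoint (\<lambda>x :: 'a :: chilbert_space. x)"
  by (intro self_adjointI bounded_clinearI[where M = 1]) auto

lemma self_adjoint_minus:
  assumes "self_adjoint A"
  shows "self_adjoint (\<lambda>x. - A x)"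
proof -
  note A = self_adjoint_bounded_clinear[OF assms]
  obtain M where M: "\<And>x. norm (A x) \<le> M * norm x"
    using bounded_clinear_bound[OF A] by blast
  show ?thesis
    by (intro self_adjointI bounded_clinearI[where M = M])
      (auto simp: bounded_clinear_algebra[OF A] M self_adjoint_cinner[OF assms] cinner_algebra
        complex_vector.scale_minus_right)
qed

lemma self_adjoint_id_minus:
  assumes "self_adjoint S"
  shows "self_adjoint (\<lambda>x. x - S x)"
proof -
  note A = self_adjoint_bounded_clinear[OF assms]
  obtain M where M: "\<And>x. norm (S x) \<le> M * norm x"
    using bounded_clinear_bound[OF A] by blast
  have "norm (x - S x) \<le> (1 + M) * norm x" for x
    using norm_triangle_ineq4[of x "S x"] M[of x] by (simp add: algebra_simps)
  then show ?thesis
    by (intro self_adjointI bounded_clinearI[where M = "1 + M"])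
      (auto simp: bounded_clinear_algebra[OF A] self_adjoint_cinner[OF assms] cinner_algebra
        complex_vector.scale_right_diff_distrib)
qed

subsection \<open>Square roots\<close>

text \<open>A fixed point \<open>S = (X + S\<^sup>2) / 2\<close> satisfies \<open>(1 - S)\<^sup>2 = 1 - X\<close>. For a contraction \<open>X\<close> the increments
  of the iteration from \<open>0\<close> are dominated by those of the same iteration for the number \<open>X = 1\<close>.\<close>

fun sqrt_iter :: "('a :: chilbert_space \<Rightarrow> 'a) \<Rightarrow> nat \<Rightarrow> 'a \<Rightarrow> 'a" where
  "sqrt_iter X 0 x = 0"
| "sqrt_iter X (Suc n) x = (1/2) *\<^sub>R (X x + sqrt_iter X n (sqrt_iter X n x))"

fun sqrt_iter_bound :: "nat \<Rightarrow> real" where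
  "sqrt_iter_bound 0 = 0"
| "sqrt_iter_bound (Suc n) = (1 + (sqrt_iter_bound n)\<^sup>2) / 2"

lemma sqrt_iter_bound_range: "0 \<le> sqrt_iter_bound n \<and> sqrt_iter_bound n \<le> 1"
  by (induction n) (auto simp: power_le_one)

lemma sqrt_iter_bound_incseq: "incseq sqrt_iter_bound"
proof (rule incseq_SucI)
  fix n
  have "0 \<le> (1 - sqrt_iter_bound n)\<^sup>2"
    by simp
  then show "sqrt_iter_bound n \<le> sqrt_iter_bound (Suc n)"
    by (simp add: power2_diff)
qed

lemma sqrt_iter_bound_Cauchy: "Cauchy sqrt_iter_bound"
  by (metis sqrt_iter_bound_incseq sqrt_iter_bound_range incseq_convergent convergent_Cauchy convergentI)

context
  fixes X :: "'a :: chilbert_space \<Rightarrow> 'a"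
  assumes sa: "self_adjoint X" and contr: "\<And>x. norm (X x) \<le> norm x"
begin

private lemma X: "bounded_clinear X"
  by (rule self_adjoint_bounded_clinear[OF sa])

lemma sqrt_iter_norm: "norm (sqrt_iter X n x) \<le> sqrt_iter_bound n * norm x"
proof (induction n arbitrary: x)
  case (Suc n)
  have "norm (sqrt_iter X n (sqrt_iter X n x)) \<le> sqrt_iter_bound n * (sqrt_iter_bound n * norm x)"
    using Suc[of "sqrt_iter X n x"] Suc[of x] sqrt_iter_bound_range[of n]
    by (meson mult_left_mono order_trans)
  then have "norm (X x + sqrt_iter X n (sqrt_iter X n x)) \<le> norm x + (sqrt_iter_bound n)\<^sup>2 * norm x"
    using contr[of x] by (intro norm_triangle_le) (simp add: power2_eq_square mult.assoc)
  then show ?case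
    by (simp add: algebra_simps del: scaleR_add_right)
qed simp

lemma sqrt_iter_bounded_clinear: "bounded_clinear (sqrt_iter X n)"
proof (rule bounded_clinearI)
  show "norm (sqrt_iter X n x) \<le> sqrt_iter_bound n * norm x" for x
    by (rule sqrt_iter_norm)
  show "sqrt_iter X n (x + y) = sqrt_iter X n x + sqrt_iter X n y" for x y
    by (induction n arbitrary: x y)
      (simp_all add: bounded_clinear_algebra[OF X] scaleR_add_right algebra_simps)
  show "sqrt_iter X n (c *\<^sub>C x) = c *\<^sub>C sqrt_iter X n x" for c x
    by (induction n arbitrary: x)
      (simp_all add: bounded_clinear_algebra[OF X] scaleR_scaleC scaleC_scaleC scaleC_add_right
        mult.commute)
qed

lemma sqrt_iter_cinner: "cinner (sqrt_iter X n x) y = cinner x (sqrt_iter X n y)"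
  by (induction n arbitrary: x y) (simp_all add: cinner_algebra self_adjoint_cinner[OF sa])

text \<open>Each iterate is a polynomial in X, so it commutes with whatever commutes with X. Used
  with another iterate as Y, this lets differences of squares factor.\<close>

lemma sqrt_iter_commute:
  assumes "bounded_clinear Y" "\<And>x. Y (X x) = X (Y x)"
  shows "Y (sqrt_iter X n x) = sqrt_iter X n (Y x)"
  by (induction n arbitrary: x) (simp_all add: bounded_clinear_algebra[OF assms(1)] assms(2))

lemma sqrt_iter_commute_self: "sqrt_iter X m (sqrt_iter X n x) = sqrt_iter X n (sqrt_iter X m x)"
  by (intro sqrt_iter_commute sqrt_iter_bounded_clinear sqrt_iter_commute[symmetric] X refl)

text \<open>With consecutive commuting iterates S and S', the next increment is (S'^2 - S^2) / 2 =
  (S' + S) (S' - S) / 2. The scalar iteration satisfies the same identity, so the domination passes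
  from one increment to the next.\<close>

lemma sqrt_iter_Suc_diff:
  "norm (sqrt_iter X (Suc n) x - sqrt_iter X n x)
    \<le> (sqrt_iter_bound (Suc n) - sqrt_iter_bound n) * norm x"
proof (induction n arbitrary: x)
  case 0
  show ?case
    using contr[of x] by simp
next
  case (Suc n)
  let ?S = "sqrt_iter X n" and ?S' = "sqrt_iter X (Suc n)"
  let ?s = "sqrt_iter_bound n" and ?s' = "sqrt_iter_bound (Suc n)"
  note lin = bounded_clinear_algebra[OF sqrt_iter_bounded_clinear]
  define d where "d = ?S' x - ?S x"
  have eq: "sqrt_iter X (Suc (Suc n)) x - ?S' x = (1/2) *\<^sub>R (?S' d + ?S d)"
  proof -
    have "sqrt_iter X (Suc (Suc n)) x - ?S' x
        = (1/2) *\<^sub>R (X x + ?S' (?S' x)) - (1/2) *\<^sub>R (X x + ?S (?S x))"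
      by (simp only: sqrt_iter.simps)
    also have "\<dots> = (1/2) *\<^sub>R (?S' (?S' x) - ?S (?S x))"
      by (simp only: scaleR_add_right scaleR_diff_right) (simp del: sqrt_iter.simps)
    also have "?S' (?S' x) - ?S (?S x) = ?S' d + ?S d"
      unfolding d_def lin using sqrt_iter_commute_self[of "Suc n" n x] by (simp del: sqrt_iter.simps)
    finally show ?thesis .
  qed
  have d: "norm d \<le> (?s' - ?s) * norm x"
    unfolding d_def by (rule Suc)
  have s: "0 \<le> ?s" "0 \<le> ?s'"
    using sqrt_iter_bound_range by blast+
  have "norm (?S' d + ?S d) \<le> (?s' + ?s) * norm d"
    using sqrt_iter_norm[of "Suc n" d] sqrt_iter_norm[of n d]
    by (intro norm_triangle_le) (simp only: distrib_right)
  also have "\<dots> \<le> (?s' + ?s) * ((?s' - ?s) * norm x)"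
    using d s by (intro mult_left_mono) auto
  also have "\<dots> = 2 * ((sqrt_iter_bound (Suc (Suc n)) - ?s') * norm x)"
    by (simp add: power2_eq_square algebra_simps add_divide_distrib)
  finally show ?case
    unfolding eq by simp
qed

lemma sqrt_iter_diff:
  assumes "m \<le> n"
  shows "norm (sqrt_iter X n x - sqrt_iter X m x)
    \<le> (sqrt_iter_bound n - sqrt_iter_bound m) * norm x"
  using assms
proof (induction n rule: dec_induct)
  case (step n)
  have "norm (sqrt_iter X (Suc n) x - sqrt_iter X m x)
      \<le> norm (sqrt_iter X (Suc n) x - sqrt_iter X n x) + norm (sqrt_iter X n x - sqrt_iter X m x)"
    using norm_triangle_ineq[of "sqrt_iter X (Suc n) x - sqrt_iter X n x"
        "sqrt_iter X n x - sqrt_iter X m x"] by (simp del: sqrt_iter.simps)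
  then show ?case
    using sqrt_iter_Suc_diff[of n x] step.IH by (simp only: left_diff_distrib)
qed simp

lemma sqrt_iter_Cauchy: "Cauchy (\<lambda>n. sqrt_iter X n x)"
proof (rule metric_CauchyI)
  fix e :: real
  assume "e > 0"
  then have "e / (norm x + 1) > 0"
    by (simp add: add_nonneg_pos)
  then obtain N where N: "\<And>m n. m \<ge> N \<Longrightarrow> n \<ge> N \<Longrightarrow>
      \<bar>sqrt_iter_bound n - sqrt_iter_bound m\<bar> < e / (norm x + 1)"
    using metric_CauchyD[OF sqrt_iter_bound_Cauchy] by (metis dist_real_def)
  have le: "norm (sqrt_iter X n x - sqrt_iter X m x) < e" if "m \<ge> N" "m \<le> n" for m n
  proof -
    have "norm (sqrt_iter X n x - sqrt_iter X m x)
        \<le> (sqrt_iter_bound n - sqrt_iter_bound m) * norm x"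
      by (rule sqrt_iter_diff[OF that(2)])
    also have "\<dots> \<le> (e / (norm x + 1)) * norm x"
      using N[of m n] that by (intro mult_right_mono) auto
    also have "\<dots> < e"
      using \<open>e > 0\<close> by (simp add: divide_less_eq add_nonneg_pos)
    finally show ?thesis .
  qed
  show "\<exists>N. \<forall>m\<ge>N. \<forall>n\<ge>N. dist (sqrt_iter X m x) (sqrt_iter X n x) < e"
    unfolding dist_norm using le by (metis nle_le norm_minus_commute)
qed

lemma sqrt_id_minus_contraction: "\<exists>Q. self_adjoint Q \<and> (\<forall>x. Q (Q x) = x - X x)"
proof -
  note lin = bounded_clinear_algebra[OF sqrt_iter_bounded_clinear]
  define S where "S x = lim (\<lambda>n. sqrt_iter X n x)" for x
  have lim: "(\<lambda>n. sqrt_iter X n x) \<longlonglongrightarrow> S x" for x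
    using sqrt_iter_Cauchy[of x] unfolding S_def by (simp add: Cauchy_convergent_iff convergent_LIMSEQ_iff)
  have le: "norm (sqrt_iter X n x) \<le> norm x" for n x
    using sqrt_iter_norm[of n x] sqrt_iter_bound_range[of n]
    by (meson mult_left_le_one_le norm_ge_zero order_trans)
  have S_le: "norm (S x) \<le> 1 * norm x" for x
    using LIMSEQ_le_const2[OF tendsto_norm[OF lim[of x]]] le by auto
  have S_add: "S (x + y) = S x + S y" for x y
    using tendsto_add[OF lim[of x] lim[of y]] lim[of "x + y"] by (simp add: lin LIMSEQ_unique)
  have S_scaleC: "S (c *\<^sub>C x) = c *\<^sub>C S x" for c x
    using bounded_linear.tendsto[OF bounded_linear_scaleC lim[of x], of c] lim[of "c *\<^sub>C x"]
    by (simp add: lin LIMSEQ_unique)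
  have S: "bounded_clinear S"
    by (rule bounded_clinearI[OF S_add S_scaleC S_le])
  have S_cinner: "cinner (S x) y = cinner x (S y)" for x y
  proof (rule LIMSEQ_unique)
    show "(\<lambda>n. cinner (sqrt_iter X n x) y) \<longlonglongrightarrow> cinner (S x) y"
      by (rule bounded_linear.tendsto[OF bounded_linear_cinner_left lim])
    show "(\<lambda>n. cinner (sqrt_iter X n x) y) \<longlonglongrightarrow> cinner x (S y)"
      unfolding sqrt_iter_cinner by (rule bounded_linear.tendsto[OF bounded_linear_cinner_right lim])
  qed
  \<comment> \<open>Convergence is only pointwise, so the square needs care: split S_n (S_n x) into
    S_n (S_n x - S x) and S_n (S x). The first part vanishes because all S_n are
    contractions.\<close>
  have SS: "(\<lambda>n. sqrt_iter X n (sqrt_iter X n x)) \<longlonglongrightarrow> S (S x)" for x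
  proof -
    have "(\<lambda>n. sqrt_iter X n (sqrt_iter X n x - S x)) \<longlonglongrightarrow> 0"
    proof (rule Lim_null_comparison)
      show "\<forall>\<^sub>F n in sequentially. norm (sqrt_iter X n (sqrt_iter X n x - S x)) \<le> norm (sqrt_iter X n x - S x)"
        using le by simp
      show "(\<lambda>n. norm (sqrt_iter X n x - S x)) \<longlonglongrightarrow> 0"
        using lim[of x] by (simp add: LIM_zero tendsto_norm_zero)
    qed
    from tendsto_add[OF this lim[of "S x"]] show ?thesis
      by (simp add: lin)
  qed
  have fix_eq: "S x = (1/2) *\<^sub>R (X x + S (S x))" for x
  proof (rule LIMSEQ_unique)
    show "(\<lambda>n. sqrt_iter X (Suc n) x) \<longlonglongrightarrow> S x"
      using lim by (rule LIMSEQ_Suc)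
    show "(\<lambda>n. sqrt_iter X (Suc n) x) \<longlonglongrightarrow> (1/2) *\<^sub>R (X x + S (S x))"
      unfolding sqrt_iter.simps by (intro tendsto_intros SS)
  qed
  have two: "S x + S x = X x + S (S x)" for x
    by (subst (1 2) fix_eq) (simp flip: scaleR_add_left)
  show ?thesis
  proof (intro exI conjI allI)
    show "self_adjoint (\<lambda>x. x - S x)"
      using S S_cinner by (intro self_adjoint_id_minus self_adjointI)
    show "x - S x - S (x - S x) = x - X x" for x
      using two[of x] by (simp add: bounded_clinear_algebra[OF S] algebra_simps)
  qed
qed

end

section \<open>Square roots of bounded positive operators\<close>

lemma self_adjoint_scaleR:
  assumes "self_adjoint A"
  shows "self_adjoint (\<lambda>x. r *\<^sub>R A x)"
proof -
  note A = self_adjoint_bounded_clinear[OF assms]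
  obtain M where M: "\<And>x. norm (A x) \<le> M * norm x"
    using bounded_clinear_bound[OF A] by blast
  have "norm (r *\<^sub>R A x) \<le> \<bar>r\<bar> * M * norm x" for x
    using M[of x] by (simp add: mult.assoc mult_left_mono)
  then show ?thesis
    by (intro self_adjointI bounded_clinearI[where M = "\<bar>r\<bar> * M"])
      (auto simp: bounded_clinear_algebra[OF A] self_adjoint_cinner[OF assms] cinner_algebra
        scaleR_scaleC scaleC_scaleC mult.commute scaleC_add_right)
qed

lemma cinner_positive:
  assumes "positive_op P"
  shows "cinner x (P x) = of_real (Re (cinner x (P x)))" "Re (cinner x (P x)) \<ge> 0"
  using assms unfolding positive_op_def less_eq_complex_def by (auto simp: complex_eq_iff)

text \<open>For a norm bound c of P, the operator X = 1 - P / c is a contraction, which amounts to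
  the estimate \<parallel>P x\<parallel>^2 \<le> c \<langle>x, P x\<rangle>. The square root of 1 -
  X = P / c is then rescaled by \<open>sqrt c\<close>.\<close>

lemma positive_op_sqrt:
  assumes P: "positive_op P"
  shows "\<exists>Q. self_adjoint Q \<and> (\<forall>x. Q (Q x) = P x)"
proof -
  have sa: "self_adjoint P"
    using P by (simp add: positive_op_def)
  note lin = bounded_clinear_algebra[OF self_adjoint_bounded_clinear[OF sa]]
  obtain c where c: "c > 0" "\<And>x. norm (P x) \<le> c * norm x"
    using bounded_clinear_bound[OF self_adjoint_bounded_clinear[OF sa]] by blast
  define X where "X x = x - (1/c) *\<^sub>R P x" for x
  have X: "self_adjoint X"
    unfolding X_def by (intro self_adjoint_id_minus self_adjoint_scaleR sa)
  have "norm (X x) \<le> norm x" for x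
  proof -
    have xP: "Re (cinner x (P (P x))) = (norm (P x))\<^sup>2"
      by (simp add: self_adjoint_cinner[OF sa, symmetric] cinner_self flip: of_real_power)
    have PP: "Re (cinner (P x) (P (P x))) \<le> c * (norm (P x))\<^sup>2"
    proof -
      have "Re (cinner (P x) (P (P x))) \<le> norm (P x) * norm (P (P x))"
        using cmod_cinner_le complex_Re_le_cmod order_trans by blast
      also have "\<dots> \<le> norm (P x) * (c * norm (P x))"
        using c by (intro mult_left_mono) auto
      finally show ?thesis
        by (simp add: power2_eq_square mult.left_commute)
    qed
    \<comment> \<open>Positivity is tested at (c - P) x: the cross terms give -2 c \<parallel>P
      x\<parallel>^2, of which \<open>PP\<close> takes back at most half. This yields
      \<open>main\<close> without a square root of P.\<close>
    have "0 \<le> Re (cinner (c *\<^sub>R x - P x) (P (c *\<^sub>R x - P x)))"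
      by (rule cinner_positive[OF P])
    also have "\<dots> = c * (c * Re (cinner x (P x))) - 2 * (c * (norm (P x))\<^sup>2) + Re (cinner (P x) (P (P x)))"
      by (simp add: lin cinner_algebra xP cinner_self algebra_simps flip: of_real_power)
    also have "\<dots> \<le> c * (c * Re (cinner x (P x))) - c * (norm (P x))\<^sup>2"
      using PP by simp
    finally have "0 \<le> c * (c * Re (cinner x (P x)) - (norm (P x))\<^sup>2)"
      by (simp add: algebra_simps)
    then have main: "(norm (P x))\<^sup>2 \<le> c * Re (cinner x (P x))"
      using c by (simp add: zero_le_mult_iff)
    have pos: "0 \<le> Re (cinner x (P x))"
      by (rule cinner_positive[OF P])
    have "(norm (X x))\<^sup>2 = (norm x)\<^sup>2 - 2 * Re (cinner x (P x)) / c + (norm (P x))\<^sup>2 / c\<^sup>2"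
      using c by (simp add: X_def power2_norm_diff cinner_algebra power_divide)
    also have "\<dots> \<le> (norm x)\<^sup>2 - 2 * Re (cinner x (P x)) / c + c * Re (cinner x (P x)) / c\<^sup>2"
      using main by (intro add_left_mono divide_right_mono) auto
    also have "\<dots> = (norm x)\<^sup>2 - Re (cinner x (P x)) / c"
      using c by (simp add: power2_eq_square field_simps)
    also have "\<dots> \<le> (norm x)\<^sup>2"
      using c pos by simp
    finally show ?thesis
      by (rule power2_le_imp_le) simp
  qed
  from sqrt_id_minus_contraction[OF X this] obtain Q
    where Q: "self_adjoint Q" "\<And>x. Q (Q x) = (1/c) *\<^sub>R P x"
    by (auto simp: X_def)
  note Qlin = bounded_clinear_algebra[OF self_adjoint_bounded_clinear[OF Q(1)]]
  show ?thesis
  proof (intro exI conjI allI)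
    show "self_adjoint (\<lambda>x. sqrt c *\<^sub>R Q x)"
      by (rule self_adjoint_scaleR[OF Q(1)])
    show "sqrt c *\<^sub>R Q (sqrt c *\<^sub>R Q x) = P x" for x
      using c by (simp add: Qlin Q(2))
  qed
qed

section \<open>Orthonormal bases\<close>

lemma subspace_closure:
  assumes "complex_vector.subspace (S :: 'a :: complex_inner set)"
  shows "complex_vector.subspace (closure S)"
proof (rule complex_vector.subspaceI)
  show "0 \<in> closure S"
    using complex_vector.subspace_0[OF assms] closure_subset by blast
  show "x + y \<in> closure S" if xy: "x \<in> closure S" "y \<in> closure S" for x y
  proof -
    obtain f g where f: "\<And>n. f n \<in> S" "f \<longlonglongrightarrow> x" and g: "\<And>n. g n \<in> S" "g \<longlonglongrightarrow> y"
      using xy unfolding closure_sequential by blast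
    have "(\<lambda>n. f n + g n) \<longlonglongrightarrow> x + y"
      by (intro tendsto_add f g)
    moreover have "f n + g n \<in> S" for n
      by (intro complex_vector.subspace_add[OF assms] f g)
    ultimately show ?thesis
      unfolding closure_sequential by (intro exI[of _ "\<lambda>n. f n + g n"]) simp
  qed
  show "c *\<^sub>C x \<in> closure S" if x: "x \<in> closure S" for c x
  proof -
    obtain f where f: "\<And>n. f n \<in> S" "f \<longlonglongrightarrow> x"
      using x unfolding closure_sequential by blast
    have "(\<lambda>n. c *\<^sub>C f n) \<longlonglongrightarrow> c *\<^sub>C x"
      by (rule bounded_linear.tendsto[OF bounded_linear_scaleC f(2)])
    moreover have "c *\<^sub>C f n \<in> S" for n
      by (intro complex_vector.subspace_scale[OF assms] f)
    ultimately show ?thesis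
      unfolding closure_sequential by (intro exI[of _ "\<lambda>n. c *\<^sub>C f n"]) simp
  qed
qed

lemma closure_cspan_subset:
  fixes B :: "'a :: complex_inner set"
  assumes "B \<subseteq> S" "complex_vector.subspace S" "closed S"
  shows "closure (cspan B) \<subseteq> S"
  by (intro closure_minimal complex_vector.span_minimal assms)

lemma bounded_clinear_eqI:
  fixes f g :: "'a :: complex_inner \<Rightarrow> 'b :: complex_inner"
  assumes f: "bounded_clinear f" and g: "bounded_clinear g"
    and dense: "closure (cspan B) = UNIV" and eq: "\<And>x. x \<in> B \<Longrightarrow> f x = g x"
  shows "f = g"
proof -
  have "closed {x. f x = g x}"
    using f g by (intro closed_Collect_eq bounded_clinear_bounded_linear linear_continuous_on)
  then have "closure (cspan B) \<subseteq> {x. f x = g x}"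
    using f g by (intro closure_cspan_subset complex_vector.subspaceI)
      (auto simp: eq bounded_clinear_algebra)
  then show ?thesis
    using dense by auto
qed

lemma orthogonal_projection_exists:
  fixes M :: "'a :: chilbert_space set"
  assumes "closed M" and M: "complex_vector.subspace M"
  shows "\<exists>m\<in>M. \<forall>y\<in>M. cinner y (x - m) = 0"
proof -
  define D where "D = (\<lambda>m. (norm (x - m))\<^sup>2) ` M"
  define d where "d = Inf D"
  have ne: "D \<noteq> {}"
    using complex_vector.subspace_0[OF M] by (auto simp: D_def)
  have bdd: "bdd_below D"
    by (rule bdd_belowI[of _ 0]) (auto simp: D_def)
  have d_le: "d \<le> (norm (x - m))\<^sup>2" if "m \<in> M" for m
    unfolding d_def using bdd that by (intro cInf_lower) (auto simp: D_def)
  have "\<exists>m\<in>M. (norm (x - m))\<^sup>2 < d + 1 / Suc n" for n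
    using cInf_lessD[OF ne, of "d + 1 / Suc n"] unfolding d_def[symmetric]
    by (fastforce simp: D_def)
  then obtain f where fM: "\<And>n. f n \<in> M" and f: "\<And>n. (norm (x - f n))\<^sup>2 < d + 1 / Suc n"
    by metis
  \<comment> \<open>Parallelogram law: the midpoint of two elements of M is again in M, so its
    squared distance from x is at least d. Two nearly optimal points are therefore close.\<close>
  have dist: "(norm (f i - f j))\<^sup>2 \<le> 2 / Suc i + 2 / Suc j" for i j
  proof -
    have mid: "(1/2) *\<^sub>R (f i + f j) \<in> M"
      unfolding scaleR_scaleC
      by (intro complex_vector.subspace_scale[OF M] complex_vector.subspace_add[OF M] fM)
    have "(norm (f i - f j))\<^sup>2 = (norm ((x - f j) - (x - f i)))\<^sup>2"
      by simp
    also have "\<dots> = 2 * (norm (x - f i))\<^sup>2 + 2 * (norm (x - f j))\<^sup>2 - (norm ((x - f j) + (x - f i)))\<^sup>2"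
      unfolding power2_norm_add power2_norm_diff by simp
    also have "(x - f j) + (x - f i) = 2 *\<^sub>R (x - (1/2) *\<^sub>R (f i + f j))"
      by (simp add: scaleR_diff_right scaleR_2)
    also have "(norm \<dots>)\<^sup>2 = 4 * (norm (x - (1/2) *\<^sub>R (f i + f j)))\<^sup>2"
      by (simp add: power_mult_distrib)
    finally show ?thesis
      using d_le[OF mid] f[of i] f[of j] by simp
  qed
  have "Cauchy f"
  proof (rule metric_CauchyI)
    fix e :: real
    assume "e > 0"
    then obtain N where N: "inverse (Suc N) < e\<^sup>2 / 4"
      using reals_Archimedean[of "e\<^sup>2 / 4"] by auto
    have "dist (f i) (f j) < e" if "i \<ge> N" "j \<ge> N" for i j
    proof -
      have "2 / real (Suc i) \<le> 2 / real (Suc N)" "2 / real (Suc j) \<le> 2 / real (Suc N)"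
        using that by (auto intro!: frac_le)
      moreover have "2 / real (Suc N) < e\<^sup>2 / 2"
        using N unfolding divide_inverse[of 2] by linarith
      ultimately have "(norm (f i - f j))\<^sup>2 < e\<^sup>2"
        using dist[of i j] by linarith
      then have "norm (f i - f j) < e"
        by (rule power2_less_imp_less) (use \<open>e > 0\<close> in simp)
      then show ?thesis
        by (simp add: dist_norm)
    qed
    then show "\<exists>N. \<forall>m\<ge>N. \<forall>n\<ge>N. dist (f m) (f n) < e"
      by blast
  qed
  then obtain m where m: "f \<longlonglongrightarrow> m"
    using Cauchy_convergent_iff convergent_def by blast
  have mM: "m \<in> M"
    using closed_sequentially[OF \<open>closed M\<close> fM m] .
  have "(norm (x - m))\<^sup>2 \<le> d + 0"
  proof (rule LIMSEQ_le)
    show "(\<lambda>n. (norm (x - f n))\<^sup>2) \<longlonglongrightarrow> (norm (x - m))\<^sup>2"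
      by (intro tendsto_intros m)
    show "(\<lambda>n. d + 1 / Suc n) \<longlonglongrightarrow> d + 0"
      using lim_1_over_n[THEN LIMSEQ_Suc] by (intro tendsto_intros)
    show "\<exists>N. \<forall>n\<ge>N. (norm (x - f n))\<^sup>2 \<le> d + 1 / Suc n"
      using f less_imp_le by blast
  qed
  then have min: "(norm (x - m))\<^sup>2 \<le> (norm (x - y))\<^sup>2" if "y \<in> M" for y
    using d_le[OF that] by linarith
  have "cinner y (x - m) = 0" if y: "y \<in> M" for y
  proof -
    define z where "z = x - m"
    define k where "k = cinner y z"
    \<comment> \<open>The step size along k y is chosen so that the quadratic term s^2 |k|^2
      \<parallel>y\<parallel>^2 is at most half of the linear gain 2 s |k|^2. The summand 1 in the
      denominator covers y = 0.\<close>
    define s where "s = 1 / (1 + (norm y)\<^sup>2)"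
    have s: "s > 0" "s * (norm y)\<^sup>2 \<le> 1"
      by (auto simp: s_def add_pos_nonneg divide_simps)
    have zy: "cinner z y = cnj k"
      by (simp add: k_def cinner_commute[symmetric])
    have "m + (of_real s * k) *\<^sub>C y \<in> M"
      by (intro complex_vector.subspace_scale[OF M] complex_vector.subspace_add[OF M] mM y)
    from min[OF this] have "(norm z)\<^sup>2 \<le> (norm (z - (of_real s * k) *\<^sub>C y))\<^sup>2"
      by (simp add: z_def algebra_simps)
    also have "\<dots> = (norm z)\<^sup>2 - 2 * (s * (cmod k)\<^sup>2) + s * (cmod k)\<^sup>2 * (s * (norm y)\<^sup>2)"
    proof -
      have "Re (cinner z ((of_real s * k) *\<^sub>C y)) = s * (cmod k)\<^sup>2"
        by (simp add: cinner_algebra zy cmod_power2) (simp add: power2_eq_square algebra_simps)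
      then show ?thesis
        using s by (simp add: power2_norm_diff norm_scaleC norm_mult) (simp add: power2_eq_square mult_ac)
    qed
    also have "\<dots> \<le> (norm z)\<^sup>2 - 2 * (s * (cmod k)\<^sup>2) + s * (cmod k)\<^sup>2 * 1"
      using s by (intro add_left_mono mult_left_mono) auto
    finally have "s * (cmod k)\<^sup>2 \<le> 0"
      by simp
    then show ?thesis
      using s by (simp add: mult_le_0_iff k_def z_def)
  qed
  with mM show ?thesis
    by blast
qed

text \<open>A maximal orthonormal set from Zorn's lemma has dense span: for x outside the closed
  span, the normalized difference between x and its projection could be added. This is what makes
  the choice in \<open>some_onb\<close> meaningful.\<close>

lemma is_onb_exists: "\<exists>B :: 'a :: chilbert_space set. is_onb B"
proof -
  define P where "P = {B :: 'a set. (\<forall>e\<in>B. norm e = 1) \<and> pairwise (\<lambda>e f. cinner e f = 0) B}"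
  have "\<exists>M\<in>P. \<forall>X\<in>P. M \<subseteq> X \<longrightarrow> X = M"
  proof (rule subset_Zorn')
    fix C
    assume C: "subset.chain P C"
    have "pairwise (\<lambda>e f. cinner e f = 0) (\<Union>C)"
    proof (rule pairwise_chain_Union)
      show "\<And>S. S \<in> C \<Longrightarrow> pairwise (\<lambda>e f. cinner e f = 0) S" "chain\<^sub>\<subseteq> C"
        using C by (fastforce simp: subset.chain_def P_def chain_subset_def)+
    qed
    then show "\<Union>C \<in> P"
      using C by (auto simp: subset.chain_def P_def)
  qed
  then obtain B where B: "B \<in> P" and max: "\<And>X. X \<in> P \<Longrightarrow> B \<subseteq> X \<Longrightarrow> X = B"
    by blast
  have "x \<in> closure (cspan B)" for x
  proof (rule ccontr)
    assume x: "x \<notin> closure (cspan B)"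
    have sub: "B \<subseteq> closure (cspan B)"
      using complex_vector.span_superset closure_subset by blast
    obtain m where m: "m \<in> closure (cspan B)" "\<And>y. y \<in> closure (cspan B) \<Longrightarrow> cinner y (x - m) = 0"
      using orthogonal_projection_exists[OF closed_closure subspace_closure[OF complex_vector.subspace_span]]
      by metis
    define e where "e = (1 / norm (x - m)) *\<^sub>R (x - m)"
    have "x \<noteq> m"
      using x m(1) by blast
    then have e1: "norm e = 1"
      by (simp add: e_def)
    have orth: "cinner y e = 0" if "y \<in> B" for y
      using m(2)[of y] that sub by (auto simp: e_def cinner_algebra)
    then have "cinner e y = 0" if "y \<in> B" for y
      using that cinner_commute[of e y] by simp
    with orth B e1 have "insert e B \<in> P"
      by (auto simp: P_def pairwise_insert)
    with max[of "insert e B"] have "e \<in> B"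
      by auto
    with orth have "cinner e e = 0"
      by blast
    then show False
      using e1 by (simp add: cinner_self)
  qed
  with B show ?thesis
    unfolding is_onb_def P_def by blast
qed

text \<open>Bases are indexed here so that product bases carry tuples as indices. Iterated sums over
  factors and reorderings of the factors then become operations on the index set.\<close>

definition onb_family :: "'i set \<Rightarrow> ('i \<Rightarrow> 'a :: chilbert_space) \<Rightarrow> bool"
  where "onb_family I b \<longleftrightarrow> (\<forall>i\<in>I. \<forall>j\<in>I. cinner (b i) (b j) = (if i = j then 1 else 0)) \<and>
    closure (cspan (b ` I)) = UNIV"

lemma onb_family_some_onb: "onb_family some_onb (\<lambda>e :: 'a :: chilbert_space. e)"
proof -
  have "is_onb (some_onb :: 'a set)"
    unfolding some_onb_def using is_onb_exists by (rule someI_ex)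
  then show ?thesis
    unfolding is_onb_def onb_family_def pairwise_def by (simp add: cinner_self)
qed

lemma onb_family_expansion:
  fixes b :: "'i \<Rightarrow> 'a :: chilbert_space"
  assumes b: "onb_family I b"
  shows "((\<lambda>i. cinner (b i) y *\<^sub>C b i) has_sum y) I"
  unfolding has_sum_def
proof (rule tendstoI)
  fix e :: real
  assume e: "e > 0"
  define p where "p F = (\<Sum>i\<in>F. cinner (b i) y *\<^sub>C b i)" for F
  have "y \<in> closure (cspan (b ` I))"
    using b by (simp add: onb_family_def)
  then obtain w where w: "w \<in> cspan (b ` I)" "dist w y < e"
    using e unfolding closure_approachable by blast
  then obtain T r where T: "finite T" "T \<subseteq> b ` I" and wT: "w = (\<Sum>v\<in>T. r v *\<^sub>C v)"
    unfolding complex_vector.span_explicit by blast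
  obtain F0 where F0: "F0 \<subseteq> I" "finite F0" "T = b ` F0"
    using finite_subset_image[OF T] by blast
  have "dist (p F) y < e" if F: "finite F" "F0 \<subseteq> F" "F \<subseteq> I" for F
  proof -
    have "cinner (y - p F) (b j) = 0" if j: "j \<in> F" for j
    proof -
      have "cinner (p F) (b j) = (\<Sum>i\<in>F. cnj (cinner (b i) y) * cinner (b i) (b j))"
        by (simp add: p_def cinner_sum_left cinner_scaleC_left)
      also have "\<dots> = (\<Sum>i\<in>F. if i = j then cnj (cinner (b i) y) else 0)"
        using b F j by (intro sum.cong refl) (auto simp: onb_family_def subset_iff)
      also have "\<dots> = cinner y (b j)"
        using j F by (simp add: cinner_commute[symmetric])
      finally show ?thesis
        by (simp add: cinner_diff_left)
    qed
    then have orth: "cinner (y - p F) v = 0" if "v \<in> cspan (b ` F)" for v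
      using that \<open>\<And>j. j \<in> F \<Longrightarrow> cinner (y - p F) (b j) = 0\<close>
      by (intro complex_vector.span_induct[OF that, where P = "\<lambda>v. cinner (y - p F) v = 0"])
        (auto intro!: complex_vector.subspaceI simp: cinner_add_right cinner_scaleC_right)
    have "w - p F \<in> cspan (b ` F)"
      unfolding wT p_def F0(3) using F
      by (intro complex_vector.span_diff complex_vector.span_sum complex_vector.span_scale
          complex_vector.span_base) auto
    then have "(norm ((y - p F) - (w - p F)))\<^sup>2 = (norm (y - p F))\<^sup>2 + (norm (w - p F))\<^sup>2"
      unfolding power2_norm_diff[of "y - p F"] using orth by simp
    then have "(norm (y - p F))\<^sup>2 \<le> (norm (y - w))\<^sup>2"
      by simp
    then have "norm (y - p F) \<le> norm (y - w)"
      by (rule power2_le_imp_le) simp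
    then show ?thesis
      using w(2) by (simp add: dist_norm norm_minus_commute)
  qed
  then show "\<forall>\<^sub>F F in finite_subsets_at_top I. dist (\<Sum>i\<in>F. cinner (b i) y *\<^sub>C b i) y < e"
    unfolding eventually_finite_subsets_at_top p_def using F0 by blast
qed

lemma parseval:
  assumes "onb_family I b"
  shows "((\<lambda>i. cinner x (b i) * cinner (b i) y) has_sum cinner x y) I"
  using has_sum_bounded_linear[OF bounded_linear_cinner_right onb_family_expansion[OF assms], of x y]
  by (simp add: cinner_scaleC_right mult.commute)

lemma parseval_norm:
  assumes "onb_family I b"
  shows "((\<lambda>i. (cmod (cinner (b i) x))\<^sup>2) has_sum (norm x)\<^sup>2) I"
proof -
  have "cinner x (b i) * cinner (b i) x = of_real ((cmod (cinner (b i) x))\<^sup>2)" for i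
    by (metis cinner_commute complex_norm_square mult.commute)
  then have "((\<lambda>i. complex_of_real ((cmod (cinner (b i) x))\<^sup>2)) has_sum of_real ((norm x)\<^sup>2)) I"
    using parseval[OF assms, of x x] by (simp only: cinner_self)
  from has_sum_Re[OF this] show ?thesis
    by simp
qed

section \<open>Tensor products of operators\<close>

text \<open>A densely defined contraction is given as a linear relation, so that no well-definedness
  on representations has to be shown: the bound applied to differences forces single-valuedness. The
  extension is the sequential closure R of the graph.\<close>

lemma bounded_clinear_graph_extension:
  fixes G :: "('a :: chilbert_space \<times> 'b :: chilbert_space) set"
  assumes add: "\<And>v w v' w'. (v, w) \<in> G \<Longrightarrow> (v', w') \<in> G \<Longrightarrow> (v + v', w + w') \<in> G"
    and scale: "\<And>c v w. (v, w) \<in> G \<Longrightarrow> (c *\<^sub>C v, c *\<^sub>C w) \<in> G"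
    and bound: "\<And>v w. (v, w) \<in> G \<Longrightarrow> norm w \<le> norm v"
    and dense: "closure (fst ` G) = UNIV"
  shows "\<exists>T. bounded_clinear T \<and> (\<forall>v. norm (T v) \<le> norm v) \<and> (\<forall>(v, w)\<in>G. T v = w)"
proof -
  define R where "R v w \<longleftrightarrow> (\<exists>f g. (\<forall>n. (f n, g n) \<in> G) \<and> f \<longlonglongrightarrow> v \<and> g \<longlonglongrightarrow> w)" for v w
  have RI: "R v w" if "\<And>n. (f n, g n) \<in> G" "f \<longlonglongrightarrow> v" "g \<longlonglongrightarrow> w" for f g v w
    using that unfolding R_def by blast
  have R_bound: "norm w \<le> norm v" if R: "R v w" for v w
  proof -
    obtain f g where fg: "\<And>n. (f n, g n) \<in> G" "f \<longlonglongrightarrow> v" "g \<longlonglongrightarrow> w"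
      using R unfolding R_def by blast
    show ?thesis
      by (rule LIMSEQ_le[OF tendsto_norm[OF fg(3)] tendsto_norm[OF fg(2)]]) (use bound fg(1) in blast)
  qed
  have R_add: "R (v + v') (w + w')" if R: "R v w" "R v' w'" for v w v' w'
  proof -
    obtain f g where fg: "\<And>n. (f n, g n) \<in> G" "f \<longlonglongrightarrow> v" "g \<longlonglongrightarrow> w"
      using R(1) unfolding R_def by blast
    obtain f' g' where fg': "\<And>n. (f' n, g' n) \<in> G" "f' \<longlonglongrightarrow> v'" "g' \<longlonglongrightarrow> w'"
      using R(2) unfolding R_def by blast
    show ?thesis
      by (rule RI[of "\<lambda>n. f n + f' n" "\<lambda>n. g n + g' n"]) (intro add fg fg' tendsto_add)+
  qed
  have R_scale: "R (c *\<^sub>C v) (c *\<^sub>C w)" if R: "R v w" for c v w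
  proof -
    obtain f g where fg: "\<And>n. (f n, g n) \<in> G" "f \<longlonglongrightarrow> v" "g \<longlonglongrightarrow> w"
      using R unfolding R_def by blast
    show ?thesis
      by (rule RI[of "\<lambda>n. c *\<^sub>C f n" "\<lambda>n. c *\<^sub>C g n"])
        (intro scale fg bounded_linear.tendsto[OF bounded_linear_scaleC])+
  qed
  \<comment> \<open>The pair (v - v, w - w') lies in R, so its second component has norm at most
    0.\<close>
  have R_unique: "w = w'" if "R v w" "R v w'" for v w w'
    using R_bound[OF R_add[OF that(1) R_scale[OF that(2), of "- 1"]]] by (simp add: scaleC_minus_one)
  have R_total: "\<exists>w. R v w" for v
  proof -
    have "v \<in> closure (fst ` G)"
      by (simp add: dense)
    then obtain f where f: "\<And>n. f n \<in> fst ` G" "f \<longlonglongrightarrow> v"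
      unfolding closure_sequential by blast
    then have "\<forall>n. \<exists>w. (f n, w) \<in> G"
      by force
    then obtain g where g: "\<And>n. (f n, g n) \<in> G"
      by metis
    have le: "norm (g m - g n) \<le> norm (f m - f n)" for m n
      using bound[OF add[OF g[of m] scale[OF g[of n], of "- 1"]]] by (simp add: scaleC_minus_one)
    have "Cauchy g"
    proof (rule metric_CauchyI)
      fix e :: real
      assume "e > 0"
      then obtain N where "\<forall>m\<ge>N. \<forall>n\<ge>N. dist (f m) (f n) < e"
        using metric_CauchyD[OF LIMSEQ_imp_Cauchy[OF f(2)]] by blast
      then show "\<exists>N. \<forall>m\<ge>N. \<forall>n\<ge>N. dist (g m) (g n) < e"
        using le unfolding dist_norm by (meson order_le_less_trans)
    qed
    then obtain w where "g \<longlonglongrightarrow> w"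
      using Cauchy_convergent_iff convergent_def by blast
    then show ?thesis
      using RI[OF g f(2)] by blast
  qed
  define T where "T v = (THE w. R v w)" for v
  have T: "R v (T v)" for v
    unfolding T_def using R_total R_unique by (metis theI)
  have T_eq: "T v = w" if "R v w" for v w
    using T R_unique that by blast
  show ?thesis
  proof (intro exI conjI allI ballI)
    show "bounded_clinear T"
      by (rule bounded_clinearI[where M = 1]) (auto intro!: T_eq R_add R_scale T simp: R_bound T)
    show "norm (T v) \<le> norm v" for v
      using R_bound[OF T] .
    show "case p of (v, w) \<Rightarrow> T v = w" if "p \<in> G" for p
      using that by (auto intro!: T_eq RI[OF _ tendsto_const tendsto_const])
  qed
qed

lemma self_adjointI_dense:
  assumes C: "bounded_clinear C" and dense: "closure (cspan S) = UNIV"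
    and eq: "\<And>x y. x \<in> S \<Longrightarrow> y \<in> S \<Longrightarrow> cinner (C x) y = cinner x (C y)"
  shows "self_adjoint C"
proof (rule self_adjointI[OF C])
  note lin = bounded_clinear_algebra[OF C]
  note cont = linear_continuous_on[OF bounded_clinear_bounded_linear[OF C]]
  have 1: "cinner (C x) y = cinner x (C y)" if x: "x \<in> S" for x y
  proof -
    have "closed {y. cinner (C x) y = cinner x (C y)}"
      by (intro closed_Collect_eq continuous_intros cont)
    then have "closure (cspan S) \<subseteq> {y. cinner (C x) y = cinner x (C y)}"
      using eq x by (intro closure_cspan_subset complex_vector.subspaceI) (auto simp: lin cinner_algebra)
    then show ?thesis
      using dense by auto
  qed
  show "cinner (C x) y = cinner x (C y)" for x y
  proof -
    have "closed {x. cinner (C x) y = cinner x (C y)}"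
      by (intro closed_Collect_eq continuous_intros cont)
    then have "closure (cspan S) \<subseteq> {x. cinner (C x) y = cinner x (C y)}"
      using 1 by (intro closure_cspan_subset complex_vector.subspaceI) (auto simp: lin cinner_algebra)
    then show ?thesis
      using dense by auto
  qed
qed

section \<open>Self-adjoint contractions and their tensor products\<close>

definition sa_contraction :: "('a :: chilbert_space \<Rightarrow> 'a) \<Rightarrow> bool"
  where "sa_contraction A \<longleftrightarrow> self_adjoint A \<and> (\<forall>x. norm (A x) \<le> norm x)"

lemma sa_contraction_bounded_clinear: "sa_contraction A \<Longrightarrow> bounded_clinear A"
  by (simp add: sa_contraction_def self_adjoint_def)

lemma sa_contraction_id: "sa_contraction (\<lambda>x. x)"
  by (simp add: sa_contraction_def self_adjoint_id)

lemma sa_contraction_minus: "sa_contraction A \<Longrightarrow> sa_contraction (\<lambda>x. - A x)"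
  by (simp add: sa_contraction_def self_adjoint_minus)

lemma sa_contractionI_onorm:
  assumes "self_adjoint A" "onorm A \<le> 1"
  shows "sa_contraction A"
proof -
  have "norm (A x) \<le> norm x" for x
  proof -
    have "norm (A x) \<le> onorm A * norm x"
      using assms(1) by (intro onorm) (simp add: self_adjoint_def bounded_clinear_def)
    also have "\<dots> \<le> 1 * norm x"
      using assms(2) by (intro mult_right_mono) auto
    finally show ?thesis
      by simp
  qed
  with assms(1) show ?thesis
    by (simp add: sa_contraction_def)
qed

text \<open>A list represents a vector of the algebraic tensor product, without passing to a
  quotient: concatenation is addition, and \<open>map (map_prod A B)\<close> is the action of A
  \<otimes> B on representatives.\<close>

definition tensor_sum :: "('a \<Rightarrow> 'b \<Rightarrow> 'c :: chilbert_space) \<Rightarrow> ('a \<times> 'b) list \<Rightarrow> 'c"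
  where "tensor_sum t ps = (\<Sum>(x, y)\<leftarrow>ps. t x y)"

context
  fixes t :: "'a :: chilbert_space \<Rightarrow> 'b :: chilbert_space \<Rightarrow> 'c :: chilbert_space"
  assumes t: "hilbert_tensor t"
begin

lemma
  shows tensor_add_left: "t (x + x') y = t x y + t x' y"
    and tensor_add_right: "t x (y + y') = t x y + t x y'"
    and tensor_scaleC_left: "t (c *\<^sub>C x) y = c *\<^sub>C t x y"
    and tensor_scaleC_right: "t x (c *\<^sub>C y) = c *\<^sub>C t x y"
    and cinner_tensor: "cinner (t x y) (t x' y') = cinner x x' * cinner y y'"
    and tensor_dense: "closure (cspan {t x y |x y. True}) = UNIV"
  using t unfolding hilbert_tensor_def clinear_iff by auto

lemma tensor_flip: "hilbert_tensor (\<lambda>y x. t x y)"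
proof -
  have "{t y x |x y. True} = {t x y |x y. True}"
    by blast
  then show ?thesis
    using t unfolding hilbert_tensor_def by (auto simp: mult.commute)
qed

lemma norm_tensor: "norm (t x y) = norm x * norm y"
proof -
  have "complex_of_real ((norm (t x y))\<^sup>2) = complex_of_real ((norm x * norm y)\<^sup>2)"
    by (simp only: cinner_self[symmetric] cinner_tensor power_mult_distrib of_real_mult)
  then have "(norm (t x y))\<^sup>2 = (norm x * norm y)\<^sup>2"
    by (simp only: of_real_eq_iff)
  then show ?thesis
    by simp
qed

lemma bounded_clinear_tensor_left: "bounded_clinear (\<lambda>x. t x y)"
  by (rule bounded_clinearI[where M = "norm y"])
    (auto simp: tensor_add_left tensor_scaleC_left norm_tensor)

lemma bounded_clinear_tensor_right: "bounded_clinear (t x)"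
  by (rule bounded_clinearI[where M = "norm x"])
    (auto simp: tensor_add_right tensor_scaleC_right norm_tensor)

lemmas tensor_algebra =
  bounded_clinear_algebra[OF bounded_clinear_tensor_left]
  bounded_clinear_algebra[OF bounded_clinear_tensor_right]

text \<open>Density is obtained one factor at a time. For fixed j the x with
  \<open>t x (c j)\<close> in V form a closed subspace containing the first basis, hence everything;
  then x is fixed and the second factor is treated likewise.\<close>

lemma onb_family_tensor:
  assumes b: "onb_family I b" and c: "onb_family J c"
  shows "onb_family (I \<times> J) (\<lambda>(i, j). t (b i) (c j))"
proof -
  define V where "V = closure (cspan ((\<lambda>(i, j). t (b i) (c j)) ` (I \<times> J)))"
  have V: "complex_vector.subspace V" "closed V"
    unfolding V_def by (auto intro: subspace_closure complex_vector.subspace_span)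
  have sub: "complex_vector.subspace {x. f x \<in> V}" and cl: "closed {x. f x \<in> V}"
    if f: "bounded_clinear f" for f :: "'x :: chilbert_space \<Rightarrow> 'c"
  proof -
    show "complex_vector.subspace {x. f x \<in> V}"
      using V(1) by (intro complex_vector.subspaceI)
        (auto simp: bounded_clinear_algebra[OF f] complex_vector.subspace_0
          complex_vector.subspace_add complex_vector.subspace_scale)
    show "closed {x. f x \<in> V}"
      using continuous_closed_vimage[OF V(2), of f]
        linear_continuous_at[OF bounded_clinear_bounded_linear[OF f]]
      by (simp add: vimage_def)
  qed
  have "t (b i) (c j) \<in> V" if "i \<in> I" "j \<in> J" for i j
    unfolding V_def using that
    by (intro subsetD[OF closure_subset] complex_vector.span_base image_eqI[of _ _ "(i, j)"]) auto
  then have "closure (cspan (b ` I)) \<subseteq> {x. t x (c j) \<in> V}" if "j \<in> J" for j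
    using that by (intro closure_cspan_subset sub cl bounded_clinear_tensor_left) auto
  then have "t x (c j) \<in> V" if "j \<in> J" for x j
    using that b by (auto simp: onb_family_def)
  then have "closure (cspan (c ` J)) \<subseteq> {y. t x y \<in> V}" for x
    by (intro closure_cspan_subset sub cl bounded_clinear_tensor_right) auto
  then have "t x y \<in> V" for x y
    using c by (auto simp: onb_family_def)
  then have "closure (cspan {t x y |x y. True}) \<subseteq> V"
    by (intro closure_cspan_subset V) auto
  then have "V = UNIV"
    using tensor_dense by auto
  then show ?thesis
    using b c unfolding onb_family_def V_def[symmetric] by (auto simp: cinner_tensor)
qed

text \<open>The inner product depends on f and g only through the Gram entries of the two factors,
  so an identity between such entries can be summed term by term.\<close>

lemma cinner_tensor_sum:
  "cinner (tensor_sum t (map (map_prod f g) ps)) (tensor_sum t (map (map_prod f g) qs))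
    = (\<Sum>p\<leftarrow>ps. \<Sum>q\<leftarrow>qs. cinner (f (fst p)) (f (fst q)) * cinner (g (snd p)) (g (snd q)))"
proof (induction ps)
  case (Cons p ps)
  have "cinner (t x y) (tensor_sum t (map (map_prod f g) qs))
      = (\<Sum>q\<leftarrow>qs. cinner x (f (fst q)) * cinner y (g (snd q)))" for x y
    by (induction qs) (auto simp: tensor_sum_def cinner_algebra cinner_tensor split_beta)
  with Cons show ?case
    by (auto simp: tensor_sum_def cinner_algebra split_beta)
qed (simp add: tensor_sum_def)

text \<open>With \<open>Q\<^sup>2 = 1 - A\<^sup>2\<close>, the map \<open>v \<mapsto> ((A \<otimes> 1) v, (Q \<otimes> 1) v)\<close> is isometric on finite sums.\<close>

lemma norm_tensor_sum_left_le:
  assumes "sa_contraction A"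
  shows "norm (tensor_sum t (map (map_prod A (\<lambda>y. y)) ps)) \<le> norm (tensor_sum t ps)"
proof -
  have A: "self_adjoint A" "\<And>x. norm (A x) \<le> norm x"
    using assms by (auto simp: sa_contraction_def)
  have AA: "self_adjoint (\<lambda>x. A (A x))"
    using self_adjoint_bounded_clinear[OF A(1)] self_adjoint_cinner[OF A(1)]
    by (intro self_adjointI bounded_clinear_compose[of A A]) metis+
  have "norm (A (A x)) \<le> norm x" for x
    by (rule order_trans[OF A(2) A(2)])
  from sqrt_id_minus_contraction[OF AA this]
  obtain Q where Q: "self_adjoint Q" "\<And>x. Q (Q x) = x - A (A x)"
    by (elim exE conjE) simp
  have split: "cinner (A x) (A y) + cinner (Q x) (Q y) = cinner x y" for x y
    by (simp add: self_adjoint_cinner[OF A(1)] self_adjoint_cinner[OF Q(1)] Q(2) cinner_diff_right)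
  let ?n = "\<lambda>f. tensor_sum t (map (map_prod f (\<lambda>y. y)) ps)"
  have "cinner (?n A) (?n A) + cinner (?n Q) (?n Q) = cinner (?n (\<lambda>x. x)) (?n (\<lambda>x. x))"
    unfolding cinner_tensor_sum sum_list_addf[symmetric] distrib_right[symmetric] split ..
  then have "complex_of_real ((norm (?n A))\<^sup>2 + (norm (?n Q))\<^sup>2) = complex_of_real ((norm (tensor_sum t ps))\<^sup>2)"
    by (simp add: cinner_self map_prod_def split_beta)
  then have "(norm (?n A))\<^sup>2 + (norm (?n Q))\<^sup>2 = (norm (tensor_sum t ps))\<^sup>2"
    by (simp only: of_real_eq_iff)
  then have "(norm (?n A))\<^sup>2 \<le> (norm (tensor_sum t ps))\<^sup>2"
    by (metis le_add_same_cancel1 zero_le_power2)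
  then show ?thesis
    by (rule power2_le_imp_le) simp
qed

end

context
  fixes t :: "'a :: chilbert_space \<Rightarrow> 'b :: chilbert_space \<Rightarrow> 'c :: chilbert_space"
  assumes t: "hilbert_tensor t"
begin

text \<open>A \<otimes> B is the composition of A \<otimes> 1 and 1 \<otimes> B; the latter is
  bounded by the one-sided estimate applied to the flipped tensor product.\<close>

lemma norm_tensor_sum_le:
  assumes A: "sa_contraction A" and B: "sa_contraction B"
  shows "norm (tensor_sum t (map (map_prod A B) ps)) \<le> norm (tensor_sum t ps)"
proof -
  have flip: "tensor_sum (\<lambda>y x. t x y) (map (\<lambda>(x, y). (y, x)) qs) = tensor_sum t qs" for qs
    unfolding tensor_sum_def
    by (induction qs) auto
  have "norm (tensor_sum t (map (map_prod A B) ps))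
      = norm (tensor_sum t (map (map_prod A (\<lambda>y. y)) (map (map_prod (\<lambda>x. x) B) ps)))"
    by (simp add: comp_def prod.map_comp)
  also have "\<dots> \<le> norm (tensor_sum t (map (map_prod (\<lambda>x. x) B) ps))"
    by (rule norm_tensor_sum_left_le[OF t A])
  also have "\<dots> = norm (tensor_sum (\<lambda>y x. t x y) (map (map_prod B (\<lambda>y. y)) (map (\<lambda>(x, y). (y, x)) ps)))"
    by (subst flip[symmetric]) (simp add: comp_def split_beta map_prod_def)
  also have "\<dots> \<le> norm (tensor_sum (\<lambda>y x. t x y) (map (\<lambda>(x, y). (y, x)) ps))"
    by (rule norm_tensor_sum_left_le[OF tensor_flip[OF t] B])
  also have "\<dots> = norm (tensor_sum t ps)"
    by (rule arg_cong[OF flip])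
  finally show ?thesis .
qed

lemma tensor_op_exists:
  assumes A: "sa_contraction A" and B: "sa_contraction B"
  shows "\<exists>C. bounded_clinear C \<and> (\<forall>v. norm (C v) \<le> norm v) \<and> (\<forall>x y. C (t x y) = t (A x) (B y))"
proof -
  let ?s = "tensor_sum t"
  define G where "G = (\<lambda>ps. (?s ps, ?s (map (map_prod A B) ps))) ` UNIV"
  note A' = bounded_clinear_algebra[OF sa_contraction_bounded_clinear[OF A]]
  have append: "?s (ps @ qs) = ?s ps + ?s qs" for ps qs
    by (simp add: tensor_sum_def)
  have scale: "?s (map (map_prod (\<lambda>x. c *\<^sub>C x) (\<lambda>y. y)) ps) = c *\<^sub>C ?s ps" for c ps
    by (induction ps) (auto simp: tensor_sum_def tensor_scaleC_left[OF t] scaleC_add_right)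
  have G_add: "(v + v', w + w') \<in> G" if "(v, w) \<in> G" "(v', w') \<in> G" for v w v' w'
  proof -
    obtain ps qs where "v = ?s ps" "w = ?s (map (map_prod A B) ps)" "v' = ?s qs" "w' = ?s (map (map_prod A B) qs)"
      using \<open>(v, w) \<in> G\<close> \<open>(v', w') \<in> G\<close> unfolding G_def by blast
    then show ?thesis
      unfolding G_def by (intro image_eqI[of _ _ "ps @ qs"]) (simp_all add: append)
  qed
  have G_scale: "(c *\<^sub>C v, c *\<^sub>C w) \<in> G" if vw: "(v, w) \<in> G" for c v w
  proof -
    obtain ps where "v = ?s ps" "w = ?s (map (map_prod A B) ps)"
      using vw unfolding G_def by blast
    \<comment> \<open>Scalars are carried by the first components of the list, where homogeneity of
      A lets them pass through the action of A \<otimes> B.\<close>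
    moreover have "map (map_prod A B) (map (map_prod (\<lambda>x. c *\<^sub>C x) (\<lambda>y. y)) ps)
        = map (map_prod (\<lambda>x. c *\<^sub>C x) (\<lambda>y. y)) (map (map_prod A B) ps)"
      by (auto simp: A'(2))
    ultimately show ?thesis
      unfolding G_def
      by (intro image_eqI[where x = "map (map_prod (\<lambda>x. c *\<^sub>C x) (\<lambda>y. y)) ps"] UNIV_I)
        (simp only: scale)
  qed
  have G_t: "(t x y, t (A x) (B y)) \<in> G" for x y
    unfolding G_def by (intro image_eqI[of _ _ "[(x, y)]"]) (simp_all add: tensor_sum_def)
  have "complex_vector.subspace (fst ` G)"
  proof (rule complex_vector.subspaceI)
    show "0 \<in> fst ` G"
      using imageI[OF G_scale[OF G_t, of 0], of fst] by simp
    show "v + v' \<in> fst ` G" if v: "v \<in> fst ` G" "v' \<in> fst ` G" for v v'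
    proof -
      obtain w w' where "(v, w) \<in> G" "(v', w') \<in> G"
        using v by auto
      from imageI[OF G_add[OF this], of fst] show ?thesis
        by simp
    qed
    show "c *\<^sub>C v \<in> fst ` G" if v: "v \<in> fst ` G" for c v
    proof -
      obtain w where "(v, w) \<in> G"
        using v by auto
      from imageI[OF G_scale[OF this, of c], of fst] show ?thesis
        by simp
    qed
  qed
  moreover have "{t x y |x y. True} \<subseteq> fst ` G"
    using imageI[OF G_t, of fst] by auto
  ultimately have "cspan {t x y |x y. True} \<subseteq> fst ` G"
    by (intro complex_vector.span_minimal)
  then have dense: "closure (fst ` G) = UNIV"
    using tensor_dense[OF t] closure_mono[of "cspan {t x y |x y. True}" "fst ` G"]
    by (simp add: top.extremum_unique)
  have bound: "norm w \<le> norm v" if "(v, w) \<in> G" for v w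
    using that norm_tensor_sum_le[OF A B] unfolding G_def by auto
  have "\<exists>C. bounded_clinear C \<and> (\<forall>v. norm (C v) \<le> norm v) \<and> (\<forall>(v, w)\<in>G. C v = w)"
    by (rule bounded_clinear_graph_extension[OF _ _ _ dense]) (fact G_add, fact G_scale, fact bound)
  then obtain C where C: "bounded_clinear C" "\<And>v. norm (C v) \<le> norm v"
      and C_G: "\<And>p. p \<in> G \<Longrightarrow> C (fst p) = snd p"
    by (auto simp: split_beta)
  have "C (t x y) = t (A x) (B y)" for x y
    using C_G[OF G_t] by simp
  with C show ?thesis
    by blast
qed

lemma tensor_op_eqI:
  assumes C: "bounded_clinear C" and eq: "\<And>x y. C (t x y) = t (A x) (B y)"
  shows "tensor_op t A B = C"
  unfolding tensor_op_def
proof (rule the_equality)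
  show "C' = C" if C': "bounded_clinear C' \<and> (\<forall>x y. C' (t x y) = t (A x) (B y))" for C'
    using C' C by (intro bounded_clinear_eqI[OF _ _ tensor_dense[OF t]]) (auto simp: eq)
qed (simp add: C eq)

lemma
  assumes A: "sa_contraction A" and B: "sa_contraction B"
  shows sa_contraction_tensor_op: "sa_contraction (tensor_op t A B)"
    and tensor_op_apply: "tensor_op t A B (t x y) = t (A x) (B y)"
proof -
  obtain C where C: "bounded_clinear C" "\<And>v. norm (C v) \<le> norm v" "\<And>x y. C (t x y) = t (A x) (B y)"
    using tensor_op_exists[OF A B] by blast
  have eq: "tensor_op t A B = C"
    by (rule tensor_op_eqI[OF C(1,3)])
  show "tensor_op t A B (t x y) = t (A x) (B y)"
    by (simp add: eq C)
  have "self_adjoint C"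
    by (rule self_adjointI_dense[OF C(1) tensor_dense[OF t]])
      (use A B in \<open>auto simp: C(3) cinner_tensor[OF t] sa_contraction_def self_adjoint_def\<close>)
  then show "sa_contraction (tensor_op t A B)"
    by (simp add: eq sa_contraction_def C(2))
qed

lemma tensor_op_id: "tensor_op t (\<lambda>x. x) (\<lambda>y. y) = (\<lambda>v. v)"
  by (intro tensor_op_eqI self_adjoint_bounded_clinear self_adjoint_id) simp

lemma tensor_op_minus_left:
  assumes A: "sa_contraction A" and B: "sa_contraction B"
  shows "tensor_op t (\<lambda>x. - A x) B = (\<lambda>v. - tensor_op t A B v)"
  by (intro tensor_op_eqI sa_contraction_bounded_clinear sa_contraction_minus
      sa_contraction_tensor_op A B)
    (simp add: tensor_op_apply[OF A B] tensor_algebra[OF t])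

lemma tensor_op_minus_right:
  assumes A: "sa_contraction A" and B: "sa_contraction B"
  shows "tensor_op t A (\<lambda>x. - B x) = (\<lambda>v. - tensor_op t A B v)"
  by (intro tensor_op_eqI sa_contraction_bounded_clinear sa_contraction_minus
      sa_contraction_tensor_op A B)
    (simp add: tensor_op_apply[OF A B] tensor_algebra[OF t])

end

section \<open>Traces and partial traces\<close>

text \<open>Both sides are the sum over all pairs \<open>(i, j)\<close> of
  \<open>\<langle>T S b\<^sub>i, c\<^sub>j\<rangle> \<langle>c\<^sub>j, S b\<^sub>i\<rangle>\<close>, which converges absolutely because \<open>S\<close> is Hilbert-Schmidt.\<close>

lemma
  assumes S: "self_adjoint S" and T: "sa_contraction T"
    and b: "onb_family I b" and c: "onb_family J c"
    and HS: "(\<lambda>i. (norm (S (b i)))\<^sup>2) summable_on I"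
  shows trace_change_basis:
      "((\<lambda>j. cinner (c j) (S (S (T (c j))))) has_sum (\<Sum>\<^sub>\<infinity>i\<in>I. cinner (S (b i)) (T (S (b i))))) J"
    and trace_summable: "(\<lambda>i. cinner (S (b i)) (T (S (b i)))) summable_on I"
proof -
  have Tsa: "self_adjoint T" and Tle: "\<And>x. norm (T x) \<le> norm x"
    using T by (auto simp: sa_contraction_def)
  \<comment> \<open>Parseval in c sums a row to \<langle>T S b_i, S b_i\<rangle>; after T and S are
    moved across the inner products, Parseval in b sums a column to \<langle>S c_j, S T
    c_j\<rangle>.\<close>
  define h where "h = (\<lambda>(i, j). cinner (T (S (b i))) (c j) * cinner (c j) (S (b i)))"
  have h1: "((\<lambda>j. h (i, j)) has_sum cinner (S (b i)) (T (S (b i)))) J" for i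
    using parseval[OF c, of "T (S (b i))" "S (b i)"] by (simp add: h_def self_adjoint_cinner[OF Tsa])
  have h2: "((\<lambda>i. h (i, j)) has_sum cinner (c j) (S (S (T (c j))))) I" for j
    using parseval[OF b, of "S (c j)" "S (T (c j))"]
    by (simp add: h_def self_adjoint_cinner[OF Tsa] self_adjoint_cinner[OF S] mult.commute)
  \<comment> \<open>A majorant of |h| from |x| |y| \<le> |x|^2 + |y|^2. Its row sums are
    \<parallel>T S b_i\<parallel>^2 + \<parallel>S b_i\<parallel>^2, both controlled by
    \<open>HS\<close>.\<close>
  define g where "g = (\<lambda>(i, j). (cmod (cinner (c j) (T (S (b i)))))\<^sup>2 + (cmod (cinner (c j) (S (b i))))\<^sup>2)"
  have "g summable_on I \<times> J"
  proof (rule summable_on_SigmaI)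
    show "((\<lambda>j. g (i, j)) has_sum (norm (T (S (b i))))\<^sup>2 + (norm (S (b i)))\<^sup>2) J" for i
      using has_sum_add[OF parseval_norm[OF c] parseval_norm[OF c]] by (simp add: g_def)
    have "(\<lambda>i. (norm (T (S (b i))))\<^sup>2) summable_on I"
      by (rule summable_on_comparison_test[OF HS]) (auto intro: power_mono Tle)
    then show "(\<lambda>i. (norm (T (S (b i))))\<^sup>2 + (norm (S (b i)))\<^sup>2) summable_on I"
      using HS by (rule summable_on_add)
  qed (auto simp: g_def)
  then have "(\<lambda>p. norm (h p)) summable_on I \<times> J"
  proof (rule Infinite_Sum.abs_summable_on_comparison_test')
    have le: "cmod x * cmod y \<le> (cmod x)\<^sup>2 + (cmod y)\<^sup>2" for x y
      using sum_squares_bound[of "cmod x" "cmod y"] mult_nonneg_nonneg[OF norm_ge_zero norm_ge_zero, of x y] by linarith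
    have "cmod (cinner (T (S (b i))) (c j)) = cmod (cinner (c j) (T (S (b i))))" for i j
      by (metis cinner_commute complex_mod_cnj)
    then show "norm (h p) \<le> g p" for p
      using le by (auto simp: h_def g_def norm_mult split: prod.split)
  qed
  then have h: "h summable_on I \<times> J"
    by (rule Infinite_Sum.abs_summable_summable)
  then obtain s where s: "(h has_sum s) (I \<times> J)"
    unfolding summable_on_def by blast
  have sI: "((\<lambda>i. cinner (S (b i)) (T (S (b i)))) has_sum s) I"
    using has_sum_SigmaD[OF s h1] .
  have "((\<lambda>(j, i). h (i, j)) has_sum s) (J \<times> I)"
    using s by (simp add: has_sum_swap[of h])
  from has_sum_SigmaD[OF this] h2
  have "((\<lambda>j. cinner (c j) (S (S (T (c j))))) has_sum s) J"
    by simp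
  then show "((\<lambda>j. cinner (c j) (S (S (T (c j))))) has_sum (\<Sum>\<^sub>\<infinity>i\<in>I. cinner (S (b i)) (T (S (b i))))) J"
    using infsumI[OF sI] by simp
  show "(\<lambda>i. cinner (S (b i)) (T (S (b i)))) summable_on I"
    using sI unfolding summable_on_def by blast
qed

text \<open>This frees \<open>tr\<close> from the basis \<open>some_onb\<close> of the composite
  space, so that it can be evaluated in a product basis.\<close>

lemma state_trace_onb_family:
  assumes \<rho>: "quantum_state \<rho>" and T: "sa_contraction T" and c: "onb_family J c"
  shows "((\<lambda>j. cinner (c j) (\<rho> (T (c j)))) has_sum tr (\<rho> \<circ> T)) J"
proof -
  obtain S where S: "self_adjoint S" "\<And>x. S (S x) = \<rho> x"
    using positive_op_sqrt \<rho> unfolding quantum_state_def by blast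
  have diag: "cinner e (\<rho> e) = of_real ((norm (S e))\<^sup>2)" for e
    by (simp add: S(2)[symmetric] self_adjoint_cinner[OF S(1), symmetric] cinner_self)
  \<comment> \<open>An infinite sum without a value is 0 by convention, so a nonzero trace shows
    that the diagonal is summable, that is, that S is Hilbert-Schmidt.\<close>
  have "tr \<rho> \<noteq> 0"
    using \<rho> by (simp add: quantum_state_def)
  then have "(\<lambda>e. cinner e (\<rho> e)) summable_on some_onb"
    unfolding tr_def using infsum_not_exists by blast
  then have HS: "(\<lambda>e. (norm (S e))\<^sup>2) summable_on some_onb"
    using summable_on_Re unfolding diag by fastforce
  note change = trace_change_basis[OF S(1) T onb_family_some_onb _ HS, unfolded S(2)]
  have "tr (\<rho> \<circ> T) = (\<Sum>\<^sub>\<infinity>e\<in>some_onb. cinner (S e) (T (S e)))"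
    unfolding tr_def using infsumI[OF change[OF onb_family_some_onb]] by simp
  then show ?thesis
    using change[OF c] by simp
qed

lemma onb_family_reindex:
  assumes "onb_family I b" "bij_betw h J I"
  shows "onb_family J (\<lambda>j. b (h j))"
proof -
  have "(\<lambda>j. b (h j)) ` J = b ` I"
    using assms(2) by (auto simp: bij_betw_def)
  moreover have "cinner (b (h i)) (b (h j)) = (if i = j then 1 else 0)" if "i \<in> J" "j \<in> J" for i j
  proof -
    have "h i \<in> I" "h j \<in> I" "h i = h j \<longleftrightarrow> i = j"
      using that assms(2) by (auto simp: bij_betw_def inj_on_eq_iff)
    then show ?thesis
      using assms(1) unfolding onb_family_def by metis
  qed
  ultimately show ?thesis
    using assms(1) by (simp add: onb_family_def)
qed

text \<open>(1 + A) / 2 = 1 - X for the contraction X = (1 - A) / 2. The factor 1/2 also makes the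
  root a contraction, by \<parallel>Q x\<parallel>^2 = \<langle>x, Q^2 x\<rangle> \<le>
  \<parallel>x\<parallel>^2, so that it can enter \<open>tensor_op\<close>.\<close>

lemma sa_contraction_half_sqrt:
  assumes A: "sa_contraction A"
  shows "\<exists>Q. sa_contraction Q \<and> (\<forall>x. Q (Q x) = (1/2) *\<^sub>R (x + A x))"
proof -
  have sa: "self_adjoint A" and le: "\<And>x. norm (A x) \<le> norm x"
    using A by (auto simp: sa_contraction_def)
  define X where "X x = (1/2) *\<^sub>R (x - A x)" for x
  have "self_adjoint X"
    unfolding X_def by (intro self_adjoint_scaleR self_adjoint_id_minus sa)
  moreover have "norm (X x) \<le> norm x" for x
    using norm_triangle_ineq4[of x "A x"] le[of x] by (simp add: X_def del: scaleR_diff_right)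
  ultimately obtain Q where Q: "self_adjoint Q" "\<And>x. Q (Q x) = x - X x"
    using sqrt_id_minus_contraction by metis
  have half: "x - X x = (1/2) *\<^sub>R (x + A x)" for x
  proof -
    have "x - X x = (1/2) *\<^sub>R (x + x) - (1/2) *\<^sub>R (x - A x)"
      by (simp add: X_def flip: scaleR_2)
    then show ?thesis
      unfolding scaleR_diff_right[symmetric] by simp
  qed
  have "norm (Q x) \<le> norm x" for x
  proof -
    have "(norm (Q x))\<^sup>2 = Re (cinner x (Q (Q x)))"
      by (simp add: self_adjoint_cinner[OF Q(1), symmetric] cinner_self flip: of_real_power)
    also have "\<dots> \<le> norm x * norm (Q (Q x))"
      using cmod_cinner_le complex_Re_le_cmod order_trans by blast
    also have "\<dots> \<le> norm x * norm x"
    proof (rule mult_left_mono)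
      show "norm (Q (Q x)) \<le> norm x"
        unfolding Q(2) half using norm_triangle_ineq[of x "A x"] le[of x] by (simp del: scaleR_add_right)
    qed simp
    finally have "(norm (Q x))\<^sup>2 \<le> (norm x)\<^sup>2"
      by (simp only: power2_eq_square)
    then show ?thesis
      by (rule power2_le_imp_le) simp
  qed
  with Q half show ?thesis
    unfolding sa_contraction_def by metis
qed

section \<open>The inequality\<close>

definition tensor_op3 ::
    "('h :: chilbert_space \<Rightarrow> 'h \<Rightarrow> 'k :: chilbert_space) \<Rightarrow> ('k \<Rightarrow> 'h \<Rightarrow> 'l :: chilbert_space) \<Rightarrow>
     ('h \<Rightarrow> 'h) \<Rightarrow> ('h \<Rightarrow> 'h) \<Rightarrow> ('h \<Rightarrow> 'h) \<Rightarrow> 'l \<Rightarrow> 'l"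
  where "tensor_op3 t u A B C = tensor_op u (tensor_op t A B) C"

context
  fixes t :: "'h :: chilbert_space \<Rightarrow> 'h \<Rightarrow> 'k :: chilbert_space"
    and u :: "'k \<Rightarrow> 'h \<Rightarrow> 'l :: chilbert_space"
  assumes t: "hilbert_tensor t" and u: "hilbert_tensor u"
begin

lemma
  assumes "sa_contraction A" "sa_contraction B" "sa_contraction C"
  shows sa_contraction_tensor_op3: "sa_contraction (tensor_op3 t u A B C)"
    and tensor_op3_apply: "tensor_op3 t u A B C (u (t x y) z) = u (t (A x) (B y)) (C z)"
  using assms unfolding tensor_op3_def
  by (simp_all add: sa_contraction_tensor_op[OF t] sa_contraction_tensor_op[OF u]
      tensor_op_apply[OF t] tensor_op_apply[OF u])

lemma bounded_clinear_eqI_tensor3: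
  assumes f: "bounded_clinear f" and g: "bounded_clinear g"
    and eq: "\<And>x y z. f (u (t x y) z) = g (u (t x y) z)"
  shows "f = g"
proof (rule bounded_clinear_eqI[OF f g tensor_dense[OF u]])
  have "(\<lambda>k. f (u k z)) = (\<lambda>k. g (u k z))" for z
    by (rule bounded_clinear_eqI[OF _ _ tensor_dense[OF t]])
      (auto simp: eq intro: bounded_clinear_compose[OF f] bounded_clinear_compose[OF g]
        bounded_clinear_tensor_left[OF u])
  then show "f v = g v" if "v \<in> {u x y |x y. True}" for v
    using that by (auto dest: fun_cong)
qed

text \<open>The operator version of
  \<open>1 + a b + a c + b c = ((1 + a) (1 + b) (1 + c) + (1 - a) (1 - b) (1 - c)) / 2 \<ge> 0\<close>
  for \<open>a, b, c \<in> [-1, 1]\<close>.\<close>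

lemma tensor_op3_pairs_nonneg:
  assumes A: "sa_contraction A" and B: "sa_contraction B" and C: "sa_contraction C"
  shows "0 \<le> cinner v v + cinner v (tensor_op3 t u A B (\<lambda>z. z) v)
    + cinner v (tensor_op3 t u A (\<lambda>y. y) C v) + cinner v (tensor_op3 t u (\<lambda>x. x) B C v)"
proof -
  note minus = sa_contraction_half_sqrt[OF sa_contraction_minus]
  obtain a where a: "sa_contraction a" "\<And>x. a (a x) = (1/2) *\<^sub>R (x + A x)"
    using sa_contraction_half_sqrt[OF A] by blast
  obtain b where b: "sa_contraction b" "\<And>x. b (b x) = (1/2) *\<^sub>R (x + B x)"
    using sa_contraction_half_sqrt[OF B] by blast
  obtain c where c: "sa_contraction c" "\<And>x. c (c x) = (1/2) *\<^sub>R (x + C x)"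
    using sa_contraction_half_sqrt[OF C] by blast
  obtain a' where a': "sa_contraction a'" "\<And>x. a' (a' x) = (1/2) *\<^sub>R (x + - A x)"
    using minus[OF A] by blast
  obtain b' where b': "sa_contraction b'" "\<And>x. b' (b' x) = (1/2) *\<^sub>R (x + - B x)"
    using minus[OF B] by blast
  obtain c' where c': "sa_contraction c'" "\<And>x. c' (c' x) = (1/2) *\<^sub>R (x + - C x)"
    using minus[OF C] by blast
  let ?I = "\<lambda>x :: 'h. x"
  define D where "D = tensor_op3 t u a b c"
  define D' where "D' = tensor_op3 t u a' b' c'"
  have D: "self_adjoint D" and D': "self_adjoint D'"
    unfolding D_def D'_def using sa_contraction_tensor_op3 t u a b c a' b' c'
    by (auto simp: sa_contraction_def)
  define N where "N v = v + tensor_op3 t u A B ?I v + tensor_op3 t u A ?I C v + tensor_op3 t u ?I B C v" for v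
  \<comment> \<open>D^2 and D'^2 are products of three operators (1 \<plusminus> A) / 2 and so on;
    their factor 1/8 against the required 1/2 leaves 4.\<close>
  define M where "M v = 4 *\<^sub>R (D (D v) + D' (D' v))" for v
  note ops = sa_contraction_tensor_op3[OF A B sa_contraction_id]
    sa_contraction_tensor_op3[OF A sa_contraction_id C]
    sa_contraction_tensor_op3[OF sa_contraction_id B C]
  note lins = ops[THEN sa_contraction_bounded_clinear]
  have add: "bounded_clinear (\<lambda>v. f v + g v)" if fg: "bounded_clinear f" "bounded_clinear g" for f g :: "'l \<Rightarrow> 'l"
    unfolding bounded_clinear_def clinear_iff
    using fg by (auto intro: bounded_linear_add bounded_clinear_bounded_linear
        simp: bounded_clinear_algebra[OF fg(1)] bounded_clinear_algebra[OF fg(2)] scaleC_add_right)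
  have "N = M"
  proof (rule bounded_clinear_eqI_tensor3)
    show "bounded_clinear N"
      unfolding N_def using self_adjoint_bounded_clinear[OF self_adjoint_id] by (intro add lins)
    note 2 = self_adjoint_scaleR[THEN self_adjoint_bounded_clinear, of _ 2]
    have "M = (\<lambda>v. (2 *\<^sub>R D (2 *\<^sub>R D v)) + (2 *\<^sub>R D' (2 *\<^sub>R D' v)))"
      unfolding M_def
      by (simp add: bounded_clinear_scaleR[OF self_adjoint_bounded_clinear[OF D]]
          bounded_clinear_scaleR[OF self_adjoint_bounded_clinear[OF D']] scaleR_add_right)
    then show "bounded_clinear M"
      by (simp only: add[OF bounded_clinear_compose[OF 2[OF D] 2[OF D]]
          bounded_clinear_compose[OF 2[OF D'] 2[OF D']]])
    show "N (u (t x y) z) = M (u (t x y) z)" for x y z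
    proof -
      \<comment> \<open>Terms with an odd number of the operators A, B, C cancel between the two
        products; the others occur twice.\<close>
      have "u (t (x + A x) (y + B y)) (z + C z) + u (t (x + - A x) (y + - B y)) (z + - C z)
          = N (u (t x y) z) + N (u (t x y) z)"
        unfolding N_def tensor_op3_apply[OF A B sa_contraction_id]
          tensor_op3_apply[OF A sa_contraction_id C] tensor_op3_apply[OF sa_contraction_id B C]
        by (simp add: tensor_algebra[OF t] tensor_algebra[OF u] algebra_simps)
      moreover have "M (u (t x y) z) = 4 *\<^sub>R ((1/8) *\<^sub>R (u (t (x + A x) (y + B y)) (z + C z)
          + u (t (x + - A x) (y + - B y)) (z + - C z)))"
        unfolding M_def D_def D'_def tensor_op3_apply[OF a(1) b(1) c(1)] tensor_op3_apply[OF a'(1) b'(1) c'(1)]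
          a(2) b(2) c(2) a'(2) b'(2) c'(2)
        by (simp only: tensor_algebra(3,9)[OF t] tensor_algebra(3,9)[OF u]
            scaleR_scaleR scaleR_add_right[symmetric]) simp
      ultimately show ?thesis
        by (simp flip: scaleR_2)
    qed
  qed
  have "cinner v v + cinner v (tensor_op3 t u A B ?I v) + cinner v (tensor_op3 t u A ?I C v)
      + cinner v (tensor_op3 t u ?I B C v) = cinner v (N v)"
    by (simp add: N_def cinner_add_right)
  also have "\<dots> = 4 * (cinner (D v) (D v) + cinner (D' v) (D' v))"
    unfolding \<open>N = M\<close>
    by (simp add: M_def cinner_algebra self_adjoint_cinner[OF D] self_adjoint_cinner[OF D'])
  also have "\<dots> \<ge> 0"
    by (simp add: cinner_self less_eq_complex_def)
  finally show ?thesis .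
qed

context
  fixes \<rho> :: "'k \<Rightarrow> 'k" and R :: "'l \<Rightarrow> 'l"
  assumes state: "quantum_state \<rho>" and R: "positive_op R"
    and ptrace: "has_ptrace1 t u R \<rho>" "has_ptrace2 t u R \<rho>" "has_ptrace3 t u R \<rho>"
begin

text \<open>The functional \<phi> T is the trace of R T written with S on both sides. Hence the
  total is a sum of quadratic forms of the nonnegative operator from
  \<open>tensor_op3_pairs_nonneg\<close>, taken at the vectors \<open>S (w3 p)\<close>.\<close>

lemma trace_pairs_nonneg:
  assumes A: "sa_contraction A" and B: "sa_contraction B" and C: "sa_contraction C"
  shows "0 \<le> 1 + tr (\<rho> \<circ> tensor_op t A B) + tr (\<rho> \<circ> tensor_op t A C) + tr (\<rho> \<circ> tensor_op t B C)"
proof -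
  let ?E = "some_onb :: 'h set" and ?I = "\<lambda>x :: 'h. x"
  obtain S where S: "self_adjoint S" "\<And>x. S (S x) = R x"
    using positive_op_sqrt[OF R] by blast
  have tr2: "((\<lambda>(x, y). cinner (t x y) (\<rho> (t (A x) (B y)))) has_sum tr (\<rho> \<circ> tensor_op t A B)) (?E \<times> ?E)"
    if "sa_contraction A" "sa_contraction B" for A B
    using state_trace_onb_family[OF state sa_contraction_tensor_op[OF t that]
        onb_family_tensor[OF t onb_family_some_onb onb_family_some_onb]]
    by (simp add: case_prod_unfold tensor_op_apply[OF t that])
  \<comment> \<open>The same product basis in three index orders: the factor to be traced out has
    the last index, so that the inner sum of an iterated summation is the corresponding partial
    trace.\<close>
  define w3 where "w3 = (\<lambda>((x, y), z). u (t x y) z)"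
  define w2 where "w2 = (\<lambda>((x, z), y). u (t x y) z)"
  define w1 where "w1 = (\<lambda>((y, z), x). u (t x y) z)"
  let ?EEE = "(?E \<times> ?E) \<times> ?E"
  have w3: "onb_family ?EEE w3"
    using onb_family_tensor[OF u onb_family_tensor[OF t onb_family_some_onb onb_family_some_onb] onb_family_some_onb]
    by (simp add: w3_def case_prod_unfold)
  have "bij_betw (\<lambda>((x, z), y). ((x, y), z)) ?EEE ?EEE"
    by (rule bij_betwI[where g = "\<lambda>((x, z), y). ((x, y), z)"]) auto
  from onb_family_reindex[OF w3 this] have w2: "onb_family ?EEE w2"
    by (simp add: w3_def w2_def case_prod_unfold)
  have "bij_betw (\<lambda>((y, z), x). ((x, y), z)) ?EEE ?EEE"
    by (rule bij_betwI[where g = "\<lambda>((x, y), z). ((y, z), x)"]) auto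
  from onb_family_reindex[OF w3 this] have w1: "onb_family ?EEE w1"
    by (simp add: w3_def w1_def case_prod_unfold)
  \<comment> \<open>Summing over the third factor turns the diagonal of R into that of \<rho> in the
    product basis, which is summable by \<open>tr2\<close> with two identities.\<close>
  have HS: "(\<lambda>p. (norm (S (w3 p)))\<^sup>2) summable_on ?EEE"
  proof (rule summable_on_SigmaI)
    have diag: "cinner (w3 p) (R (w3 p)) = of_real ((norm (S (w3 p)))\<^sup>2)" for p
      by (simp add: S(2)[symmetric] self_adjoint_cinner[OF S(1), symmetric] cinner_self)
    have "((\<lambda>z. cinner (w3 ((x, y), z)) (R (w3 ((x, y), z)))) has_sum cinner (t x y) (\<rho> (t x y))) ?E" for x y
      using ptrace(3) by (simp add: has_ptrace3_def w3_def)
    from has_sum_Re[OF this[unfolded diag]]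
    show "((\<lambda>z. (norm (S (w3 (q, z))))\<^sup>2) has_sum (case q of (x, y) \<Rightarrow> Re (cinner (t x y) (\<rho> (t x y))))) ?E" for q
      by (cases q) simp
    have "(\<lambda>(x, y). cinner (t x y) (\<rho> (t x y))) summable_on ?E \<times> ?E"
      using tr2[OF sa_contraction_id sa_contraction_id] unfolding summable_on_def by blast
    from summable_on_Re[OF this]
    show "(\<lambda>(x, y). Re (cinner (t x y) (\<rho> (t x y)))) summable_on ?E \<times> ?E"
      by (simp add: case_prod_unfold)
  qed simp
  define \<phi> where "\<phi> T = (\<Sum>\<^sub>\<infinity>p\<in>?EEE. cinner (S (w3 p)) (T (S (w3 p))))" for T
  have sum: "(\<lambda>p. cinner (S (w3 p)) (T (S (w3 p)))) summable_on ?EEE" if "sa_contraction T" for T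
    by (rule trace_summable[OF S(1) that w3 w3 HS])
  have \<phi>: "((\<lambda>p. cinner (w p) (R (T (w p)))) has_sum \<phi> T) ?EEE"
    if "sa_contraction T" "onb_family ?EEE w" for T w
    unfolding \<phi>_def using trace_change_basis[OF S(1) that(1) w3 that(2) HS] by (simp add: S(2))
  note id = sa_contraction_id[where 'a = 'h]
  \<comment> \<open>Stated for arbitrary contractions because two identities in place of A and B
    give the normalization \<open>one\<close> as well.\<close>
  have 12: "\<phi> (tensor_op3 t u A B ?I) = tr (\<rho> \<circ> tensor_op t A B)"
    if AB: "sa_contraction A" "sa_contraction B" for A B
  proof (rule has_sum_unique[OF _ tr2[OF AB]])
    note sums = has_sum_SigmaD[OF \<phi>[OF sa_contraction_tensor_op3[OF AB id] w3]]
    show "((\<lambda>(x, y). cinner (t x y) (\<rho> (t (A x) (B y)))) has_sum \<phi> (tensor_op3 t u A B ?I)) (?E \<times> ?E)"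
    proof (rule sums)
      show "((\<lambda>z. cinner (w3 (q, z)) (R (tensor_op3 t u A B ?I (w3 (q, z)))))
          has_sum (case q of (x, y) \<Rightarrow> cinner (t x y) (\<rho> (t (A x) (B y))))) ?E" for q
        using ptrace(3) by (simp add: has_ptrace3_def w3_def tensor_op3_apply[OF AB id] split_beta)
    qed
  qed
  have 13: "\<phi> (tensor_op3 t u A ?I C) = tr (\<rho> \<circ> tensor_op t A C)"
  proof (rule has_sum_unique[OF _ tr2[OF A C]])
    note sums = has_sum_SigmaD[OF \<phi>[OF sa_contraction_tensor_op3[OF A id C] w2]]
    show "((\<lambda>(x, y). cinner (t x y) (\<rho> (t (A x) (C y)))) has_sum \<phi> (tensor_op3 t u A ?I C)) (?E \<times> ?E)"
    proof (rule sums)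
      show "((\<lambda>z. cinner (w2 (q, z)) (R (tensor_op3 t u A ?I C (w2 (q, z)))))
          has_sum (case q of (x, y) \<Rightarrow> cinner (t x y) (\<rho> (t (A x) (C y))))) ?E" for q
        using ptrace(2) by (simp add: has_ptrace2_def w2_def tensor_op3_apply[OF A id C] split_beta)
    qed
  qed
  have 23: "\<phi> (tensor_op3 t u ?I B C) = tr (\<rho> \<circ> tensor_op t B C)"
  proof (rule has_sum_unique[OF _ tr2[OF B C]])
    note sums = has_sum_SigmaD[OF \<phi>[OF sa_contraction_tensor_op3[OF id B C] w1]]
    show "((\<lambda>(x, y). cinner (t x y) (\<rho> (t (B x) (C y)))) has_sum \<phi> (tensor_op3 t u ?I B C)) (?E \<times> ?E)"
    proof (rule sums)
      show "((\<lambda>z. cinner (w1 (q, z)) (R (tensor_op3 t u ?I B C (w1 (q, z)))))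
          has_sum (case q of (x, y) \<Rightarrow> cinner (t x y) (\<rho> (t (B x) (C y))))) ?E" for q
        using ptrace(1) by (simp add: has_ptrace1_def w1_def tensor_op3_apply[OF id B C] split_beta)
    qed
  qed
  have one: "\<phi> (\<lambda>v. v) = 1"
    using 12[OF id id] state
    by (simp add: tensor_op3_def tensor_op_id[OF t] tensor_op_id[OF u] comp_def quantum_state_def)
  note sum12 = sum[OF sa_contraction_tensor_op3[OF A B id]]
    and sum13 = sum[OF sa_contraction_tensor_op3[OF A id C]]
    and sum23 = sum[OF sa_contraction_tensor_op3[OF id B C]]
    and sum1 = sum[OF sa_contraction_id]
  have "\<phi> (\<lambda>v. v) + \<phi> (tensor_op3 t u A B ?I) + \<phi> (tensor_op3 t u A ?I C) + \<phi> (tensor_op3 t u ?I B C)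
    = (\<Sum>\<^sub>\<infinity>p\<in>?EEE. cinner (S (w3 p)) (S (w3 p)) + cinner (S (w3 p)) (tensor_op3 t u A B ?I (S (w3 p)))
      + cinner (S (w3 p)) (tensor_op3 t u A ?I C (S (w3 p))) + cinner (S (w3 p)) (tensor_op3 t u ?I B C (S (w3 p))))"
    unfolding \<phi>_def by (subst infsum_add | intro summable_on_add sum1 sum12 sum13 sum23)+ simp
  also have "\<dots> \<ge> 0"
    by (intro infsum_nonneg_complex summable_on_add sum1 sum12 sum13 sum23 tensor_op3_pairs_nonneg A B C)
  finally show ?thesis
    unfolding one 12[OF A B] 13 23 .
qed

lemma trace_minus_left:
  assumes "sa_contraction A" "sa_contraction B"
  shows "tr (\<rho> \<circ> tensor_op t (\<lambda>x. - A x) B) = - tr (\<rho> \<circ> tensor_op t A B)"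
proof -
  have \<rho>: "bounded_clinear \<rho>"
    using state by (simp add: quantum_state_def positive_op_def self_adjoint_def)
  show ?thesis
    by (simp add: tr_def tensor_op_minus_left[OF t assms] bounded_clinear_minus[OF \<rho>] cinner_minus_right
        infsum_uminus)
qed

lemma trace_minus_right:
  assumes "sa_contraction A" "sa_contraction B"
  shows "tr (\<rho> \<circ> tensor_op t A (\<lambda>x. - B x)) = - tr (\<rho> \<circ> tensor_op t A B)"
proof -
  have \<rho>: "bounded_clinear \<rho>"
    using state by (simp add: quantum_state_def positive_op_def self_adjoint_def)
  show ?thesis
    by (simp add: tr_def tensor_op_minus_right[OF t assms] bounded_clinear_minus[OF \<rho>] cinner_minus_right
        infsum_uminus)
qed

end

end

text \<open>The hypotheses say that c - z and c + z are both real, which makes c and z real; what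
  remains is the real criterion for an absolute value.\<close>

lemma complex_of_real_cmod_leI:
  assumes "0 \<le> c - z" "0 \<le> c + (z :: complex)"
  shows "complex_of_real (cmod z) \<le> c"
proof -
  have "Im z = 0" "Im c = 0" and "\<bar>Re z\<bar> \<le> Re c"
    using assms by (auto simp: less_eq_complex_def)
  then show ?thesis
    by (simp add: less_eq_complex_def cmod_eq_Re)
qed

theorem theorem2:
  fixes t :: "'h :: chilbert_space \<Rightarrow> 'h \<Rightarrow> 'k :: chilbert_space"
    and u :: "'k \<Rightarrow> 'h \<Rightarrow> 'l :: chilbert_space"
    and \<rho> :: "'k \<Rightarrow> 'k"
    and R :: "'l \<Rightarrow> 'l"
    and W\<^sub>1 W\<^sub>1' W\<^sub>2 W\<^sub>2' :: "'h \<Rightarrow> 'h"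
  assumes separable: "separable_space (euclidean :: 'h topology)"
    and tensor2: "hilbert_tensor t"
    and tensor3: "hilbert_tensor u"
    and state: "DSO_state t u \<rho>"
    and dso: "density_source_operator t u \<rho> R"
    and ptrace: "has_ptrace1 t u R \<rho>" "has_ptrace2 t u R \<rho>" "has_ptrace3 t u R \<rho>"
    and observables: "self_adjoint W\<^sub>1" "self_adjoint W\<^sub>1'" "self_adjoint W\<^sub>2" "self_adjoint W\<^sub>2'"
    and norms: "onorm W\<^sub>1 \<le> 1" "onorm W\<^sub>1' \<le> 1" "onorm W\<^sub>2 \<le> 1" "onorm W\<^sub>2' \<le> 1"
  shows "complex_of_real (cmod (tr (\<rho> \<circ> tensor_op t W\<^sub>1 W\<^sub>2) - tr (\<rho> \<circ> tensor_op t W\<^sub>1 W\<^sub>2')))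
           \<le> 1 - tr (\<rho> \<circ> tensor_op t W\<^sub>2 W\<^sub>2') \<and>
         complex_of_real (cmod (tr (\<rho> \<circ> tensor_op t W\<^sub>1 W\<^sub>2) - tr (\<rho> \<circ> tensor_op t W\<^sub>1' W\<^sub>2)))
           \<le> 1 - tr (\<rho> \<circ> tensor_op t W\<^sub>1 W\<^sub>1')"
proof -
  have \<rho>: "quantum_state \<rho>"
    using state by (simp add: DSO_state_def)
  have R: "positive_op R"
    using dso by (simp add: density_source_operator_def)
  note W = observables[THEN sa_contractionI_onorm]
  have W1: "sa_contraction W\<^sub>1" and W1': "sa_contraction W\<^sub>1'"
    and W2: "sa_contraction W\<^sub>2" and W2': "sa_contraction W\<^sub>2'"
    using W norms by auto
  note nonneg = trace_pairs_nonneg[OF tensor2 tensor3 \<rho> R ptrace]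
  note neg = sa_contraction_minus
  note minus = trace_minus_left[OF tensor2 tensor3 \<rho> R ptrace]
    trace_minus_right[OF tensor2 tensor3 \<rho> R ptrace]
  show ?thesis
  proof (intro conjI complex_of_real_cmod_leI)
    \<comment> \<open>The triple is \<open>W\<^sub>1\<close>, \<open>W\<^sub>2\<close>,
      \<open>W\<^sub>2'\<close>. Negating either of the last two reverses the sign of their common
      correlation and of exactly one correlation with \<open>W\<^sub>1\<close>, which gives the two
      signs of the difference.\<close>
    show "0 \<le> 1 - tr (\<rho> \<circ> tensor_op t W\<^sub>2 W\<^sub>2') - (tr (\<rho> \<circ> tensor_op t W\<^sub>1 W\<^sub>2) - tr (\<rho> \<circ> tensor_op t W\<^sub>1 W\<^sub>2'))"
      using nonneg[OF W1 neg[OF W2] W2'] by (simp add: minus W1 W2 W2' algebra_simps)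
    show "0 \<le> 1 - tr (\<rho> \<circ> tensor_op t W\<^sub>2 W\<^sub>2') + (tr (\<rho> \<circ> tensor_op t W\<^sub>1 W\<^sub>2) - tr (\<rho> \<circ> tensor_op t W\<^sub>1 W\<^sub>2'))"
      using nonneg[OF W1 W2 neg[OF W2']] by (simp add: minus W1 W2 W2' algebra_simps)
    \<comment> \<open>Now the triple is \<open>W\<^sub>1\<close>, \<open>W\<^sub>1'\<close>,
      \<open>W\<^sub>2\<close>, with one of the first two negated.\<close>
    show "0 \<le> 1 - tr (\<rho> \<circ> tensor_op t W\<^sub>1 W\<^sub>1') - (tr (\<rho> \<circ> tensor_op t W\<^sub>1 W\<^sub>2) - tr (\<rho> \<circ> tensor_op t W\<^sub>1' W\<^sub>2))"
      using nonneg[OF neg[OF W1] W1' W2] by (simp add: minus W1 W1' W2 algebra_simps)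
    show "0 \<le> 1 - tr (\<rho> \<circ> tensor_op t W\<^sub>1 W\<^sub>1') + (tr (\<rho> \<circ> tensor_op t W\<^sub>1 W\<^sub>2) - tr (\<rho> \<circ> tensor_op t W\<^sub>1' W\<^sub>2))"
      using nonneg[OF W1 neg[OF W1'] W2] by (simp add: minus W1 W1' W2 algebra_simps)
  qed
qed

end
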